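(* For every $\ell\in\{4,6,8,10,12,16\}$, the graph $S_\ell(19)$ (the switching graph of isomorphism classes of Steiner triple systems of order 19 in which only cycles of length $\ell$ may be switched) is disconnected. Moreover, for every such $\ell$, the graph obtained from $S_\ell(19)$ by deleting all vertices that represent systems containing no $\ell$-cycle is still disconnected.
   Context: A Steiner triple system of order $v$, $\mathrm{STS}(v)$, is a pair $(V,\mathcal B)$ with $|V|=v$ and $\mathcal B$ a collection of 3-subsets of $V$ (blocks) such that every pair of distinct points lies in exactly one block. Two $\mathrm{STS}(v)$s are isomorphic if some bijection of point sets maps blocks to blocks. Cycles: for distinct points $a,b$ let $c$ be the point with $\{a,b,c\}\in\mathcal B$. The cycle graph $C_{ab}$ has vertex set $V\setminus\{a,b,c\}$ and edges $B\setminus\{a\}$ for each block $B\ni a$, $B\ne\{a,b,c\}$, and $B\setminus\{b\}$ for each block $B\ni b$, $B\neq\{a,b,c\}$. It is 2-regular of order $v-3$ and each of its cycles has even length at least 4. An $\ell$-cycle of the system is a cycle of length $\ell$ in some $C_{ab}$. Cycle switch: if $x_1,\dots,x_{2k}$ are the vertices of a cycle in $C_{ab}$, the system contains blocks $\{a,x_1,x_2\},\{a,x_3,x_4\},\dots,\{a,x_{2k-1},x_{2k}\}$ and $\{b,x_2,x_3\},\dots,\{b,x_{2k-2},x_{2k-1}\},\{b,x_{2k},x_1\}$; switching the cycle means exchanging the roles of $a$ and $b$ in these $2k$ blocks, which gives another $\mathrm{STS}(v)$. Switching graph: $S_\ell(v)$ is the simple undirected graph whose vertices are the isomorphism classes of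 $\mathrm{STS}(v)$s, two distinct classes being adjacent if and only if a system in one of them can be transformed by switching a single $\ell$-cycle into a system in the other. *)

theory Defs
  imports
    "HOL-Combinatorics.Transposition"
    "Graph_Theory.Graph_Theory"
begin

type_synonym 'a system = "'a set \<times> 'a set set"

abbreviation points :: "'a system \<Rightarrow> 'a set" where "points \<equiv> fst"
abbreviation blocks :: "'a system \<Rightarrow> 'a set set" where "blocks \<equiv> snd"

definition sts :: "nat \<Rightarrow> 'a system \<Rightarrow> bool" where
  "sts v S \<longleftrightarrow>
     finite (points S) \<and> card (points S) = v \<and>
     (\<forall>K\<in>blocks S. K \<subseteq> points S \<and> card K = 3) \<and>
     (\<forall>x\<in>points S. \<forall>y\<in>points S. x \<noteq> y \<longrightarrow> (\<exists>!K. K \<in> blocks S \<and> {x, y} \<subseteq> K))"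

definition sts_iso :: "'a system \<Rightarrow> 'b system \<Rightarrow> bool" where
  "sts_iso S T \<longleftrightarrow>
     (\<exists>f. bij_betw f (points S) (points T) \<and> (\<lambda>K. f ` K) ` blocks S = blocks T)"

definition third_point :: "'a system \<Rightarrow> 'a \<Rightarrow> 'a \<Rightarrow> 'a" where
  "third_point S a b = (THE c. {a, b, c} \<in> blocks S)"

definition cycle_graph_verts :: "'a system \<Rightarrow> 'a \<Rightarrow> 'a \<Rightarrow> 'a set" where
  "cycle_graph_verts S a b = points S - {a, b, third_point S a b}"

definition cycle_graph_edges :: "'a system \<Rightarrow> 'a \<Rightarrow> 'a \<Rightarrow> 'a set set" where
  "cycle_graph_edges S a b =
     {K - {a} | K. K \<in> blocks S \<and> a \<in> K \<and> K \<noteq> {a, b, third_point S a b}} \<union>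
     {K - {b} | K. K \<in> blocks S \<and> b \<in> K \<and> K \<noteq> {a, b, third_point S a b}}"

text \<open>A cycle is given by the list of its vertices in cyclic order; the last
  vertex is adjacent to the first.\<close>

definition cyclic_edges :: "'a list \<Rightarrow> 'a set set" where
  "cyclic_edges xs = {{xs ! i, xs ! (Suc i mod length xs)} | i. i < length xs}"

definition is_cycle_in :: "'a system \<Rightarrow> 'a \<Rightarrow> 'a \<Rightarrow> 'a list \<Rightarrow> bool" where
  "is_cycle_in S a b xs \<longleftrightarrow>
     a \<in> points S \<and> b \<in> points S \<and> a \<noteq> b \<and>
     length xs \<ge> 3 \<and> distinct xs \<and>
     set xs \<subseteq> cycle_graph_verts S a b \<and> cyclic_edges xs \<subseteq> cycle_graph_edges S a b"

definition has_cycle :: "nat \<Rightarrow> 'a system \<Rightarrow> bool" where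
  "has_cycle l S \<longleftrightarrow> (\<exists>a b xs. is_cycle_in S a b xs \<and> length xs = l)"

definition cycle_blocks :: "'a system \<Rightarrow> 'a \<Rightarrow> 'a \<Rightarrow> 'a list \<Rightarrow> 'a set set" where
  "cycle_blocks S a b xs =
     {K \<in> blocks S. \<exists>e\<in>cyclic_edges xs. K = insert a e \<or> K = insert b e}"

definition cycle_switch :: "'a system \<Rightarrow> 'a \<Rightarrow> 'a \<Rightarrow> 'a list \<Rightarrow> 'a system" where
  "cycle_switch S a b xs =
     (points S,
      (blocks S - cycle_blocks S a b xs) \<union>
      (\<lambda>K. transpose a b ` K) ` cycle_blocks S a b xs)"

definition switches_to :: "nat \<Rightarrow> 'a system \<Rightarrow> 'a system \<Rightarrow> bool" where
  "switches_to l S T \<longleftrightarrow>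
     (\<exists>a b xs. is_cycle_in S a b xs \<and> length xs = l \<and> T = cycle_switch S a b xs)"

text \<open>Every system of order \<open>v\<close> is isomorphic to one whose points are natural
  numbers, so isomorphism classes are taken among the latter.\<close>

definition sts_rel :: "nat \<Rightarrow> (nat system \<times> nat system) set" where
  "sts_rel v = {(S, T). sts v S \<and> sts v T \<and> sts_iso S T}"

definition sts_classes :: "nat \<Rightarrow> nat system set set" where
  "sts_classes v = {S. sts v S} // sts_rel v"

definition switching_graph :: "nat \<Rightarrow> nat \<Rightarrow> nat system set pair_pre_digraph" where
  "switching_graph l v =
     \<lparr> pverts = sts_classes v,
       parcs = {(C, D). C \<in> sts_classes v \<and> D \<in> sts_classes v \<and> C \<noteq> D \<and>
                        (\<exists>S\<in>C. \<exists>T\<in>D. switches_to l S T \<or> switches_to l T S)} \<rparr>"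

text \<open>The classes removed here are those none of whose members has an \<open>l\<close>-cycle;
  having one is an isomorphism invariant.\<close>

definition reduced_switching_graph ::
    "nat \<Rightarrow> nat \<Rightarrow> (nat system set, nat system set \<times> nat system set) pre_digraph" where
  "reduced_switching_graph l v =
     with_proj (switching_graph l v) \<restriction>
       (sts_classes v - {C. \<forall>S\<in>C. \<not> has_cycle l S})"

text \<open>The graph without vertices is not \<^const>\<open>connected\<close> in the library's sense,
  but it must not count as disconnected either.\<close>

definition disconnected :: "('a, 'b) pre_digraph \<Rightarrow> bool" where
  "disconnected G \<longleftrightarrow> verts G \<noteq> {} \<and> \<not> connected G"

lemma sts_iso_refl: "sts_iso S S"
  unfolding sts_iso_def by (intro exI[of _ id]) simp

lemma sts_iso_sym:
  assumes "sts v S" "sts_iso S T"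
  shows "sts_iso T S"
proof -
  from assms(2) obtain f where f: "bij_betw f (points S) (points T)"
    and B: "(\<lambda>K. f ` K) ` blocks S = blocks T"
    unfolding sts_iso_def by blast
  let ?g = "inv_into (points S) f"
  have "?g ` f ` K = K" if "K \<in> blocks S" for K
    using that assms(1) f
    by (intro inv_into_image_cancel) (simp_all add: sts_def bij_betw_def)
  then have "(\<lambda>K. ?g ` K) ` (\<lambda>K. f ` K) ` blocks S = blocks S"
    by (simp only: image_image[of "\<lambda>K. ?g ` K"] cong: image_cong_simp) simp
  then have "(\<lambda>K. ?g ` K) ` blocks T = blocks S"
    by (simp only: B)
  with bij_betw_inv_into[OF f] show ?thesis
    unfolding sts_iso_def by (intro exI[of _ ?g] conjI)
qed

lemma sts_iso_trans:
  assumes "sts_iso S T" "sts_iso T U"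
  shows "sts_iso S U"
proof -
  from assms(1) obtain f where
    f: "bij_betw f (points S) (points T)" "(\<lambda>K. f ` K) ` blocks S = blocks T"
    unfolding sts_iso_def by (elim exE conjE)
  from assms(2) obtain g where
    g: "bij_betw g (points T) (points U)" "(\<lambda>K. g ` K) ` blocks T = blocks U"
    unfolding sts_iso_def by (elim exE conjE)
  have "(\<lambda>K. (g \<circ> f) ` K) = (\<lambda>K. g ` K) \<circ> (\<lambda>K. f ` K)"
    by (simp add: fun_eq_iff image_comp)
  then have "(\<lambda>K. (g \<circ> f) ` K) ` blocks S = blocks U"
    by (simp only: image_comp[symmetric] f(2) g(2))
  with bij_betw_trans[OF f(1) g(1)] show ?thesis
    unfolding sts_iso_def by (intro exI[of _ "g \<circ> f"] conjI)
qed

lemma equiv_sts_rel: "equiv {S. sts v S} (sts_rel v)"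
proof (rule equivI)
  show "sts_rel v \<subseteq> {S. sts v S} \<times> {S. sts v S}"
    unfolding sts_rel_def by blast
  show "refl_on {S. sts v S} (sts_rel v)"
    unfolding sts_rel_def by (rule refl_onI) (simp add: sts_iso_refl)
  show "sym (sts_rel v)"
    unfolding sts_rel_def by (rule symI) (blast intro: sts_iso_sym)
  show "trans (sts_rel v)"
    unfolding sts_rel_def by (rule transI) (blast intro: sts_iso_trans)
qed

lemma pair_bidirected_switching_graph:
  "pair_bidirected_digraph (switching_graph l v)"
proof
  show "symmetric (with_proj (switching_graph l v))"
    unfolding symmetric_def sym_def with_proj_simps switching_graph_def by auto
qed (auto simp: switching_graph_def)

end

theory Submission
  imports Defs
begin

text \<open>Connectivity is refuted with one invariant.  Call a pair \<open>a\<close>, \<open>b\<close> mixed if its cycle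
  graph contains both a 4-cycle and a 6-cycle, so that for order 19 it splits as 4 + 6 + 6.
  One system, \<open>mixed_table\<close>, has a mixed pair together with cycles of all the lengths
  in question (\<open>mixed_cycles\<close>).  For every \<open>l\<close> there is also a family of systems that
  is closed, up to isomorphism, under switching \<open>l\<close>-cycles, has a member with an \<open>l\<close>-cycle,
  and has no member with a mixed pair.  No path of the switching graph leaves the
  classes of that family, so the class of \<open>mixed_table\<close> cannot be reached from it, and both
  classes survive the deletion of the classes without \<open>l\<close>-cycles
  (\<open>disconnected_by_family\<close>).

  The families are as follows.

  \<^item> \<open>l = 4\<close> and \<open>l = 12\<close>: a twin pair of systems, each with a single Pasch configuration
    (four blocks on six points, giving one 4-cycle for each of three pairs).
    Switching it exchanges the two twins.  In these systems a 4-cycle is accompanied by a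
    12-cycle, and switching the one instead of the other gives the same result up to
    interchanging \<open>a\<close> and \<open>b\<close>.

  \<^item> \<open>l = 8\<close>: a single system with just one pair of type 8 + 8; switching either
    8-cycle gives an isomorphic copy of the system.

  \<^item> \<open>l = 16\<close>: such a cycle spans its cycle graph, and switching it amounts to interchanging
    \<open>a\<close> and \<open>b\<close>, so every class is isolated (\<open>hamiltonian_switch\<close>).

  \<^item> \<open>l = 6\<close> and \<open>l = 10\<close>: all systems in which nine inner points carry a subsystem, while
    the blocks meeting the other ten outer points are prescribed.  Those blocks amount to a
    one-factorisation of the complete graph on the outer points, with the inner points as the
    factors.  The factorisation is perfect, that is, any two factors form a Hamiltonian
    cycle.  For two inner points the cycle graph
    therefore consists of a 10-cycle on the outer points and a remainder among the inner points;
    switching the former permutes two factors and switching the latter only changes the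
    subsystem.  For all other pairs a 6-cycle or 10-cycle is impossible: if just one point of
    the pair is inner, every cycle length is divisible by 4 (\<open>mixed_pair\<close>), and if both are
    outer, the prescribed blocks determine the cycle graph (\<open>outer_pair\<close>).

  The remaining claims concern five explicit systems.  Since two cycles of a cycle graph that
  meet have the same vertices (\<open>cycles_meet_eq\<close>), and only the vertex set matters for
  switching (\<open>cycle_switch_cong\<close>), it suffices to exhibit one partition of each cycle graph
  into cycles and to check it.\<close>

section \<open>Steiner triple systems as third-point operations\<close>

lemma sts_points:
  assumes "sts v S"
  shows "finite (points S)" "card (points S) = v"
proof -
  note S = assms[unfolded sts_def]
  show "finite (points S)" using S by (rule conjunct1)
  show "card (points S) = v" using conjunct2[OF S] by (rule conjunct1)
qed

lemma sts_blockD: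
  assumes "sts v S" "K \<in> blocks S"
  shows "K \<subseteq> points S" "card K = 3"
proof -
  note S = assms(1)[unfolded sts_def]
  have "\<forall>K\<in>blocks S. K \<subseteq> points S \<and> card K = 3"
    using conjunct2[OF conjunct2[OF S]] by (rule conjunct1)
  from bspec[OF this assms(2)] show "K \<subseteq> points S" "card K = 3" by simp_all
qed

lemma sts_ex1_block:
  assumes "sts v S" "x \<in> points S" "y \<in> points S" "x \<noteq> y"
  shows "\<exists>!K. K \<in> blocks S \<and> {x, y} \<subseteq> K"
proof -
  have "\<forall>x\<in>points S. \<forall>y\<in>points S. x \<noteq> y \<longrightarrow> (\<exists>!K. K \<in> blocks S \<and> {x, y} \<subseteq> K)"
    using assms(1) unfolding sts_def by (elim conjE)
  then show ?thesis using assms(2-4) by simp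
qed

lemma sts_block_unique:
  assumes "sts v S" "K \<in> blocks S" "L \<in> blocks S"
    and "x \<in> K" "y \<in> K" "x \<in> L" "y \<in> L" "x \<noteq> y"
  shows "K = L"
proof -
  have "x \<in> points S" "y \<in> points S"
    using assms sts_blockD(1) by blast+
  from sts_ex1_block[OF assms(1) this assms(8)]
  obtain M where "\<And>N. N \<in> blocks S \<and> {x, y} \<subseteq> N \<Longrightarrow> N = M" by (elim ex1E) blast
  from this[of K] this[of L] show ?thesis using assms(2-7) by simp
qed

lemma third_point_eq:
  assumes "sts v S" "{a, b, c} \<in> blocks S"
  shows "third_point S a b = c"
  unfolding third_point_def
proof (rule the_equality)
  fix d assume d: "{a, b, d} \<in> blocks S"
  have "card {a, b, c} = 3" "card {a, b, d} = 3"
    using sts_blockD(2)[OF assms(1)] assms(2) d by blast+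
  then have "a \<noteq> b" "c \<notin> {a, b}" "d \<notin> {a, b}"
    by (auto simp: card_insert_if split: if_splits)
  moreover from \<open>a \<noteq> b\<close> have "{a, b, d} = {a, b, c}"
    by (intro sts_block_unique[OF assms(1) d assms(2), of a b]) auto
  then have "d \<in> {a, b, c}" by blast
  ultimately show "d = c" by simp
qed (fact assms(2))

lemma third_point_block:
  assumes "sts v S" "a \<in> points S" "b \<in> points S" "a \<noteq> b"
  shows "{a, b, third_point S a b} \<in> blocks S"
proof -
  obtain K where K: "K \<in> blocks S" "{a, b} \<subseteq> K"
    using sts_ex1_block[OF assms] by (elim ex1E) blast
  have "card (K - {a, b}) = 1"
    using sts_blockD[OF assms(1) K(1)] K(2) assms(4) by (simp add: card_Diff_subset)
  then obtain c where "K - {a, b} = {c}" by (auto simp: card_1_singleton_iff)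
  then have "K = {a, b, c}" using K(2) by blast
  then show ?thesis using K(1) third_point_eq[OF assms(1), of a b c] by simp
qed

lemma third_point_props:
  assumes "sts v S" "a \<in> points S" "b \<in> points S" "a \<noteq> b"
  shows "third_point S a b \<in> points S"
    and "third_point S a b \<noteq> a" and "third_point S a b \<noteq> b"
    and "third_point S b a = third_point S a b"
    and "third_point S a (third_point S a b) = b"
    and "third_point S b (third_point S a b) = a"
proof -
  let ?c = "third_point S a b"
  note B = third_point_block[OF assms]
  show "?c \<in> points S" using sts_blockD(1)[OF assms(1) B] by blast
  have "card {a, b, ?c} = 3" using sts_blockD(2)[OF assms(1) B] .
  then show "?c \<noteq> a" "?c \<noteq> b" by (auto simp: card_insert_if split: if_splits)
  have "{b, a, ?c} = {a, b, ?c}" "{a, ?c, b} = {a, b, ?c}" "{b, ?c, a} = {a, b, ?c}" by blast+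
  with B have "{b, a, ?c} \<in> blocks S" "{a, ?c, b} \<in> blocks S" "{b, ?c, a} \<in> blocks S" by simp_all
  then show "third_point S b a = ?c" "third_point S a ?c = b" "third_point S b ?c = a"
    by (simp_all add: third_point_eq[OF assms(1)])
qed

lemma sts_block_eq:
  assumes "sts v S" "K \<in> blocks S" "a \<in> K" "x \<in> K" "a \<noteq> x"
  shows "K = {a, x, third_point S a x}"
proof -
  have "a \<in> points S" "x \<in> points S" using assms(3,4) sts_blockD(1)[OF assms(1,2)] by auto
  note B = third_point_block[OF assms(1) this assms(5)]
  show ?thesis by (rule sts_block_unique[OF assms(1,2) B assms(3,4) _ _ assms(5)]) simp_all
qed

text \<open>Counting is not needed to see that a bijection carrying blocks to blocks hits every block:
  the block through two image points is the image of the block through their preimages.\<close>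

lemma sts_isoI:
  assumes S: "sts v S" and T: "sts v T"
    and f: "bij_betw f (points S) (points T)"
    and B: "\<And>K. K \<in> blocks S \<Longrightarrow> f ` K \<in> blocks T"
  shows "sts_iso S T"
proof -
  have "L \<in> (\<lambda>K. f ` K) ` blocks S" if L: "L \<in> blocks T" for L
  proof -
    have "card L = 3" and LT: "L \<subseteq> points T" using sts_blockD[OF T L] by auto
    then obtain u w where uw: "u \<in> L" "w \<in> L" "u \<noteq> w"
      by (auto simp: card_3_iff)
    then have "u \<in> f ` points S" "w \<in> f ` points S"
      using f LT by (auto simp: bij_betw_def)
    then obtain x y where xy: "x \<in> points S" "y \<in> points S" "u = f x" "w = f y" by blast
    with uw have "x \<noteq> y" by blast
    from third_point_block[OF S xy(1,2) this] have K: "{x, y, third_point S x y} \<in> blocks S" .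
    have "f ` {x, y, third_point S x y} = L"
      by (rule sts_block_unique[OF T B[OF K] L, of u w]) (use uw xy in auto)
    with K show ?thesis by blast
  qed
  then show ?thesis unfolding sts_iso_def using f B by blast
qed

lemma sts_iso_sts:
  assumes S: "sts v S" and iso: "sts_iso S T"
  shows "sts v T"
proof -
  obtain f where f: "bij_betw f (points S) (points T)" and B: "(\<lambda>K. f ` K) ` blocks S = blocks T"
    using iso unfolding sts_iso_def by blast
  have inj: "inj_on f (points S)" and im: "f ` points S = points T"
    using f by (auto simp: bij_betw_def)
  have block: "L \<subseteq> points T \<and> card L = 3" if L: "L \<in> blocks T" for L
  proof -
    have "L \<in> (\<lambda>K. f ` K) ` blocks S" using L B by simp
    then obtain K where K: "K \<in> blocks S" "L = f ` K" by (metis imageE)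
    note KS = sts_blockD[OF S K(1)]
    have "card L = card K" unfolding K(2) by (rule card_image[OF inj_on_subset[OF inj KS(1)]])
    moreover have "L \<subseteq> points T" using K(2) KS(1) im by blast
    ultimately show ?thesis using KS(2) by simp
  qed
  have join: "\<exists>!K. K \<in> blocks T \<and> {u, w} \<subseteq> K"
    if u: "u \<in> points T" and w: "w \<in> points T" and "u \<noteq> w" for u w
  proof -
    obtain x y where xy: "x \<in> points S" "y \<in> points S" "u = f x" "w = f y" "x \<noteq> y"
      using u w \<open>u \<noteq> w\<close> unfolding im[symmetric] by blast
    from third_point_block[OF S xy(1,2,5)] have K: "{x, y, third_point S x y} \<in> blocks S" .
    show ?thesis
    proof (rule ex1I[of _ "f ` {x, y, third_point S x y}"])
      show "f ` {x, y, third_point S x y} \<in> blocks T \<and> {u, w} \<subseteq> f ` {x, y, third_point S x y}"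
        using imageI[OF K, of "\<lambda>K. f ` K"] xy unfolding B by simp
    next
      fix L assume L: "L \<in> blocks T \<and> {u, w} \<subseteq> L"
      then have "L \<in> (\<lambda>K. f ` K) ` blocks S" using B by simp
      then obtain M where M: "M \<in> blocks S" "L = f ` M" by (metis imageE)
      then have "x \<in> M" "y \<in> M"
        using L xy(3,4) xy(1,2) inj_on_image_mem_iff[OF inj _ sts_blockD(1)[OF S M(1)]] by simp_all
      then show "L = f ` {x, y, third_point S x y}"
        using sts_block_eq[OF S M(1)] xy(5) M(2) by blast
    qed
  qed
  have "finite (points T)" "card (points T) = v"
    using sts_points[OF S] card_image[OF inj] unfolding im[symmetric] by simp_all
  moreover have "\<forall>K\<in>blocks T. K \<subseteq> points T \<and> card K = 3" using block by (rule ballI)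
  moreover have "\<forall>u\<in>points T. \<forall>w\<in>points T. u \<noteq> w \<longrightarrow> (\<exists>!K. K \<in> blocks T \<and> {u, w} \<subseteq> K)"
    using join by (intro ballI impI)
  ultimately show ?thesis unfolding sts_def by (intro conjI)
qed

section \<open>Cycles and switching\<close>

lemma cycle_graph_verts_commute:
  assumes "sts v S" "a \<in> points S" "b \<in> points S" "a \<noteq> b"
  shows "cycle_graph_verts S b a = cycle_graph_verts S a b"
  using third_point_props(4)[OF assms] by (auto simp: cycle_graph_verts_def)

lemma is_cycle_in_commute:
  assumes "sts v S" "is_cycle_in S a b xs"
  shows "is_cycle_in S b a xs"
proof -
  have ab: "a \<in> points S" "b \<in> points S" "a \<noteq> b"
    using assms(2) by (auto simp: is_cycle_in_def)
  have "cycle_graph_edges S b a = cycle_graph_edges S a b"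
    unfolding cycle_graph_edges_def third_point_props(4)[OF assms(1) ab] insert_commute[of b a]
    by blast
  then show ?thesis
    using assms(2) cycle_graph_verts_commute[OF assms(1) ab] by (auto simp: is_cycle_in_def)
qed

lemma cycle_switch_commute: "cycle_switch S b a xs = cycle_switch S a b xs"
proof -
  have "cycle_blocks S b a xs = cycle_blocks S a b xs" by (auto simp: cycle_blocks_def)
  then show ?thesis by (simp add: cycle_switch_def transpose_commute)
qed

lemma cycle_edge_iff:
  assumes S: "sts v S" and ab: "a \<in> points S" "b \<in> points S" "a \<noteq> b"
    and x: "x \<in> cycle_graph_verts S a b"
  shows "{x, y} \<in> cycle_graph_edges S a b \<longleftrightarrow> y = third_point S a x \<or> y = third_point S b x"
proof -
  let ?c = "third_point S a b"
  have x': "x \<in> points S" "x \<noteq> a" "x \<noteq> b" "x \<noteq> ?c" using x by (auto simp: cycle_graph_verts_def)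
  have half: "(\<exists>K. {x, y} = K - {d} \<and> K \<in> blocks S \<and> d \<in> K \<and> K \<noteq> {a, b, ?c})
      \<longleftrightarrow> y = third_point S d x" if d: "d \<in> points S" "x \<noteq> d" for d
  proof
    assume "\<exists>K. {x, y} = K - {d} \<and> K \<in> blocks S \<and> d \<in> K \<and> K \<noteq> {a, b, ?c}"
    then obtain K where K: "{x, y} = K - {d}" "K \<in> blocks S" "d \<in> K" by blast
    then have "K = {d, x, third_point S d x}" using sts_block_eq[OF S K(2,3), of x] d by blast
    with K(1) third_point_props(2,3)[OF S d(1) x'(1)] d show "y = third_point S d x"
      by (auto simp: doubleton_eq_iff)
  next
    assume y: "y = third_point S d x"
    have "{x, y} = {d, x, y} - {d}" using third_point_props(2)[OF S d(1) x'(1)] d y by auto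
    moreover have "{d, x, y} \<in> blocks S" using third_point_block[OF S d(1) x'(1)] d y by simp
    ultimately show "\<exists>K. {x, y} = K - {d} \<and> K \<in> blocks S \<and> d \<in> K \<and> K \<noteq> {a, b, ?c}"
      using x' by blast
  qed
  show ?thesis
    unfolding cycle_graph_edges_def using half[OF ab(1) x'(2)] half[OF ab(2) x'(3)] by blast
qed

lemma is_cycle_inI:
  assumes S: "sts v S" and ab: "a \<in> points S" "b \<in> points S" "a \<noteq> b"
    and xs: "3 \<le> length xs" "distinct xs" "set xs \<subseteq> cycle_graph_verts S a b"
    and step: "\<And>i. i < length xs \<Longrightarrow>
      xs ! (Suc i mod length xs) \<in> {third_point S a (xs ! i), third_point S b (xs ! i)}"
  shows "is_cycle_in S a b xs"
proof -
  have "{xs ! i, xs ! (Suc i mod length xs)} \<in> cycle_graph_edges S a b" if "i < length xs" for i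
    using cycle_edge_iff[OF S ab, of "xs ! i"] step[OF that] xs(3) that nth_mem[OF that] by blast
  then show ?thesis using ab xs by (auto simp: is_cycle_in_def cyclic_edges_def)
qed

lemma cyclic_edges_subset: "e \<in> cyclic_edges xs \<Longrightarrow> e \<subseteq> set xs"
  by (force simp: cyclic_edges_def intro: nth_mem mod_less_divisor)

text \<open>A vertex of a cycle has two different neighbours on it, and only two in the cycle graph,
  so both edges of the cycle graph at that vertex belong to the cycle.\<close>

lemma cycle_neighbours:
  assumes S: "sts v S" and cyc: "is_cycle_in S a b xs" and x: "x \<in> set xs"
  shows "{x, third_point S a x} \<in> cyclic_edges xs" "{x, third_point S b x} \<in> cyclic_edges xs"
proof -
  let ?n = "length xs"
  have ab: "a \<in> points S" "b \<in> points S" "a \<noteq> b" and n: "3 \<le> ?n" and d: "distinct xs"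
    and vs: "set xs \<subseteq> cycle_graph_verts S a b"
    and es: "cyclic_edges xs \<subseteq> cycle_graph_edges S a b"
    using cyc by (auto simp: is_cycle_in_def)
  obtain i where i: "i < ?n" "xs ! i = x" using x by (auto simp: in_set_conv_nth)
  define j where "j = (if i = 0 then ?n - 1 else i - 1)"
  have j: "j < ?n" "Suc j mod ?n = i" using i(1) n by (auto simp: j_def)
  define k where "k = Suc i mod ?n"
  have k: "k < ?n" using n unfolding k_def by (intro mod_less_divisor) linarith
  have jk: "j \<noteq> k"
    using i(1) n by (auto simp: j_def k_def mod_Suc)
  have e1: "{x, xs ! k} \<in> cyclic_edges xs"
    unfolding cyclic_edges_def using i k_def by blast
  have "{xs ! j, xs ! (Suc j mod ?n)} \<in> cyclic_edges xs"
    unfolding cyclic_edges_def using j(1) by blast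
  then have e2: "{x, xs ! j} \<in> cyclic_edges xs" using i j by (simp add: insert_commute)
  have "xs ! j \<noteq> xs ! k" using d j k jk by (simp add: nth_eq_iff_index_eq)
  moreover have "xs ! k = third_point S a x \<or> xs ! k = third_point S b x"
    "xs ! j = third_point S a x \<or> xs ! j = third_point S b x"
    using cycle_edge_iff[OF S ab] e1 e2 es vs x by blast+
  ultimately show "{x, third_point S a x} \<in> cyclic_edges xs"
    "{x, third_point S b x} \<in> cyclic_edges xs"
    using e1 e2 by auto
qed

lemma cycle_closed:
  assumes "sts v S" "is_cycle_in S a b xs" "x \<in> set xs"
  shows "third_point S a x \<in> set xs" "third_point S b x \<in> set xs"
  using cyclic_edges_subset[OF cycle_neighbours(1)[OF assms]]
    cyclic_edges_subset[OF cycle_neighbours(2)[OF assms]] by simp_all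

text \<open>Walking along the cycle never leaves a set that is closed under the two
  third-point maps.\<close>

lemma cycle_subset:
  assumes S: "sts v S" and cyc: "is_cycle_in S a b xs" and x: "x \<in> set xs" "x \<in> Y"
    and Y: "\<And>y. y \<in> Y \<Longrightarrow> y \<in> set xs \<Longrightarrow> third_point S a y \<in> Y \<and> third_point S b y \<in> Y"
  shows "set xs \<subseteq> Y"
proof
  let ?n = "length xs"
  have ab: "a \<in> points S" "b \<in> points S" "a \<noteq> b" and n: "3 \<le> ?n"
    and vs: "set xs \<subseteq> cycle_graph_verts S a b"
    and es: "cyclic_edges xs \<subseteq> cycle_graph_edges S a b"
    using cyc by (auto simp: is_cycle_in_def)
  obtain i where i: "i < ?n" "xs ! i = x" using x(1) by (auto simp: in_set_conv_nth)
  have step: "xs ! ((i + k) mod ?n) \<in> Y" for k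
  proof (induction k)
    case 0
    then show ?case using i x by simp
  next
    case (Suc k)
    let ?m = "(i + k) mod ?n"
    have m: "?m < ?n" using n by (intro mod_less_divisor) linarith
    then have "{xs ! ?m, xs ! (Suc ?m mod ?n)} \<in> cyclic_edges xs"
      unfolding cyclic_edges_def by blast
    then have "xs ! (Suc ?m mod ?n) = third_point S a (xs ! ?m) \<or>
        xs ! (Suc ?m mod ?n) = third_point S b (xs ! ?m)"
      using cycle_edge_iff[OF S ab] es vs nth_mem[OF m] by blast
    then show ?case using Y[OF Suc nth_mem[OF m]] by (auto simp: mod_Suc_eq)
  qed
  fix z assume "z \<in> set xs"
  then obtain j where j: "j < ?n" "xs ! j = z" by (auto simp: in_set_conv_nth)
  have "(i + (?n - i + j)) mod ?n = j" using i j by simp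
  then show "z \<in> Y" using step[of "?n - i + j"] j by simp
qed

lemma cycles_meet_eq:
  assumes S: "sts v S" and cyc: "is_cycle_in S a b xs" "is_cycle_in S a b ys"
    and x: "x \<in> set xs" "x \<in> set ys"
  shows "set xs = set ys"
proof
  show "set xs \<subseteq> set ys" using cycle_closed[OF S cyc(2)] by (intro cycle_subset[OF S cyc(1) x]) simp
  show "set ys \<subseteq> set xs" using cycle_closed[OF S cyc(1)] by (intro cycle_subset[OF S cyc(2) x(2,1)]) simp
qed

lemma cycle_length_card: "is_cycle_in S a b xs \<Longrightarrow> length xs = card (set xs)"
  by (simp add: is_cycle_in_def distinct_card)

text \<open>Only the vertex set of a cycle matters for switching it.\<close>

lemma cycle_blocks_eq:
  assumes S: "sts v S" and cyc: "is_cycle_in S a b xs"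
  shows "cycle_blocks S a b xs = {K \<in> blocks S. (a \<in> K \<or> b \<in> K) \<and> K \<inter> set xs \<noteq> {}}"
proof -
  have "set xs \<subseteq> cycle_graph_verts S a b" using cyc by (simp add: is_cycle_in_def)
  then have ab: "a \<notin> set xs" "b \<notin> set xs" by (auto simp: cycle_graph_verts_def)
  have ne: "e \<noteq> {}" if "e \<in> cyclic_edges xs" for e using that by (auto simp: cyclic_edges_def)
  have "\<exists>e\<in>cyclic_edges xs. K = insert a e \<or> K = insert b e"
    if K: "K \<in> blocks S" and d: "d \<in> {a, b}" "d \<in> K" and x: "x \<in> K" "x \<in> set xs" for K d x
  proof -
    have "K = insert d {x, third_point S d x}"
      using sts_block_eq[OF S K d(2) x(1)] d(1) x(2) ab by blast
    then show ?thesis using cycle_neighbours[OF S cyc x(2)] d(1) by blast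
  qed
  moreover have "(a \<in> K \<or> b \<in> K) \<and> K \<inter> set xs \<noteq> {}"
    if "e \<in> cyclic_edges xs" "K = insert a e \<or> K = insert b e" for K e
    using that ne[OF that(1)] cyclic_edges_subset[OF that(1)] by blast
  ultimately show ?thesis
    unfolding cycle_blocks_def by (intro Collect_cong) blast
qed

lemma cycle_switch_cong:
  assumes "sts v S" "is_cycle_in S a b xs" "is_cycle_in S a b ys" "set xs = set ys"
  shows "cycle_switch S a b xs = cycle_switch S a b ys"
  unfolding cycle_switch_def cycle_blocks_eq[OF assms(1,2)] cycle_blocks_eq[OF assms(1,3)] assms(4) ..

lemma cycle_switch_blocks:
  assumes "sts v S" "is_cycle_in S a b xs"
  shows "blocks (cycle_switch S a b xs) =
    (\<lambda>K. if (a \<in> K \<or> b \<in> K) \<and> K \<inter> set xs \<noteq> {} then transpose a b ` K else K) ` blocks S"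
proof -
  have "(B - {K \<in> B. P K}) \<union> h ` {K \<in> B. P K} = (\<lambda>K. if P K then h K else K) ` B"
    for B :: "'a set set" and P and h by auto
  then show ?thesis unfolding cycle_switch_def cycle_blocks_eq[OF assms] by simp
qed

section \<open>Switching is reversible and invariant under isomorphism\<close>

lemma transpose_image_block:
  assumes "a \<notin> e" "b \<notin> e"
  shows "transpose a b ` insert a e = insert b e" "transpose a b ` insert b e = insert a e"
proof -
  have "transpose a b ` e = e" using assms by (force simp: transpose_def image_iff)
  then show "transpose a b ` insert a e = insert b e" "transpose a b ` insert b e = insert a e"
    by simp_all
qed

text \<open>The same vertex list is a cycle of the switched system: its edges only change colour.\<close>

lemma switches_to_sym:
  assumes "switches_to l S T"
  shows "switches_to l T S"
proof -
  obtain a b xs where cyc: "is_cycle_in S a b xs" and l: "length xs = l"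
    and T: "T = cycle_switch S a b xs"
    using assms unfolding switches_to_def by blast
  have ab: "a \<in> points S" "b \<in> points S" "a \<noteq> b"
    and vs: "set xs \<subseteq> cycle_graph_verts S a b"
    and es: "cyclic_edges xs \<subseteq> cycle_graph_edges S a b"
    using cyc by (auto simp: is_cycle_in_def)
  have disj: "a \<notin> e" "b \<notin> e" if "e \<in> cyclic_edges xs" for e
    using cyclic_edges_subset[OF that] vs by (auto simp: cycle_graph_verts_def)
  let ?t = "\<lambda>K. transpose a b ` K"
  have form: "(\<exists>e\<in>cyclic_edges xs. ?t K = insert a e \<or> ?t K = insert b e) \<and> ?t (?t K) = K"
    if K: "\<exists>e\<in>cyclic_edges xs. K = insert a e \<or> K = insert b e" for K
  proof -
    obtain e where e: "e \<in> cyclic_edges xs" "K = insert a e \<or> K = insert b e" using K by blast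
    note transpose_image_block[OF disj[OF e(1)]]
    with e show ?thesis by metis
  qed
  define P where "P K \<longleftrightarrow> (\<exists>e\<in>cyclic_edges xs. K = insert a e \<or> K = insert b e)" for K
  have P: "P (?t K)" "?t (?t K) = K" if "P K" for K
    using form[of K] that unfolding P_def by blast+
  have C: "cycle_blocks R a b xs = {K \<in> blocks R. P K}" for R
    by (simp add: cycle_blocks_def P_def)
  have pT: "points T = points S"
    and bT: "blocks T = (blocks S - {K \<in> blocks S. P K}) \<union> ?t ` {K \<in> blocks S. P K}"
    by (simp_all add: T cycle_switch_def C)
  have CT: "{K \<in> blocks T. P K} = ?t ` {K \<in> blocks S. P K}"
    unfolding bT using P(1) by auto
  have tt: "?t ` ?t ` {K \<in> blocks S. P K} = {K \<in> blocks S. P K}"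
    using P(2) by (simp add: image_image cong: image_cong_simp)
  have "(blocks T - ?t ` {K \<in> blocks S. P K}) \<union> {K \<in> blocks S. P K} = blocks S"
    unfolding bT using P(1) by auto
  then have undo: "cycle_switch T a b xs = S"
    unfolding cycle_switch_def C CT pT tt by (simp add: prod_eq_iff)
  have through_ab: "K \<in> blocks T \<longleftrightarrow> K \<in> blocks S" if "a \<in> K" "b \<in> K" for K
  proof -
    have "K \<noteq> insert a e \<and> K \<noteq> insert b e" if "e \<in> cyclic_edges xs" for e
      using disj[OF that] \<open>a \<in> K\<close> \<open>b \<in> K\<close> ab(3) by blast
    then have "\<not> P K" unfolding P_def by blast
    then show ?thesis unfolding bT using P(1) by auto
  qed
  have third: "third_point T a b = third_point S a b"
    unfolding third_point_def by (simp add: through_ab)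
  have edge: "e \<in> cycle_graph_edges T a b" if e: "e \<in> cyclic_edges xs" for e
  proof -
    have "insert a e \<in> blocks S \<or> insert b e \<in> blocks S"
    proof -
      have "e \<in> cycle_graph_edges S a b" using es e by blast
      then obtain K d where "e = K - {d}" "K \<in> blocks S" "d \<in> K" "d = a \<or> d = b"
        unfolding cycle_graph_edges_def by blast
      then show ?thesis using insert_Diff[of d K] by metis
    qed
    moreover have "P (insert a e)" "P (insert b e)" using e unfolding P_def by blast+
    ultimately have "?t (insert a e) \<in> blocks T \<or> ?t (insert b e) \<in> blocks T"
      unfolding bT by blast
    then have "insert a e \<in> blocks T \<or> insert b e \<in> blocks T"
      unfolding transpose_image_block[OF disj[OF e]] by blast
    moreover have "b \<notin> insert a e" "a \<notin> insert b e" using disj[OF e] ab(3) by auto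
    then have "insert a e \<noteq> {a, b, third_point T a b}" "insert b e \<noteq> {a, b, third_point T a b}"
      by (metis insertI1 insertI2)+
    moreover have "e = insert a e - {a}" "e = insert b e - {b}" using disj[OF e] by blast+
    ultimately show ?thesis unfolding cycle_graph_edges_def by blast
  qed
  have "is_cycle_in T a b xs"
    using cyc edge unfolding is_cycle_in_def cycle_graph_verts_def third pT by blast
  then show ?thesis unfolding switches_to_def using l undo by metis
qed

lemma iso_third_point:
  assumes S: "sts v S" and f: "inj_on f (points S)" and T: "sts v T"
    and B: "(\<lambda>K. f ` K) ` blocks S = blocks T"
    and ab: "a \<in> points S" "b \<in> points S" "a \<noteq> b"
  shows "third_point T (f a) (f b) = f (third_point S a b)"
proof (rule third_point_eq[OF T])
  have "f ` {a, b, third_point S a b} \<in> blocks T"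
    using third_point_block[OF S ab] B by blast
  then show "{f a, f b, f (third_point S a b)} \<in> blocks T" by simp
qed

lemma iso_cycle:
  assumes S: "sts v S" and f: "bij_betw f (points S) (points T)" and T: "sts v T"
    and B: "(\<lambda>K. f ` K) ` blocks S = blocks T"
    and cyc: "is_cycle_in S a b xs"
  shows "is_cycle_in T (f a) (f b) (map f xs)"
    and "sts_iso (cycle_switch S a b xs) (cycle_switch T (f a) (f b) (map f xs))"
proof -
  have inj: "inj_on f (points S)" and im: "f ` points S = points T"
    using f by (auto simp: bij_betw_def)
  have ab: "a \<in> points S" "b \<in> points S" "a \<noteq> b" and n: "3 \<le> length xs" and d: "distinct xs"
    and vs: "set xs \<subseteq> cycle_graph_verts S a b"
    and es: "cyclic_edges xs \<subseteq> cycle_graph_edges S a b"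
    using cyc by (auto simp: is_cycle_in_def)
  have xsP: "set xs \<subseteq> points S" using vs by (auto simp: cycle_graph_verts_def)
  note third = iso_third_point[OF S inj T B]
  show cycT: "is_cycle_in T (f a) (f b) (map f xs)"
  proof (rule is_cycle_inI[OF T])
    show "f a \<in> points T" "f b \<in> points T" "f a \<noteq> f b"
      using ab im inj by (auto simp: inj_on_def)
    show "3 \<le> length (map f xs)" "distinct (map f xs)"
      using n d inj_on_subset[OF inj xsP] by (auto simp: distinct_map)
    show "set (map f xs) \<subseteq> cycle_graph_verts T (f a) (f b)"
    proof -
      have "third_point S a b \<in> points S" using third_point_props(1)[OF S ab] .
      then show ?thesis
        using vs ab inj im unfolding cycle_graph_verts_def third[OF ab]
        by (auto simp: inj_on_def subset_iff)
    qed
  next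
    fix i assume "i < length (map f xs)"
    then have i: "i < length xs" by simp
    then have i': "Suc i mod length xs < length xs" by (intro mod_less_divisor) linarith
    have x: "xs ! i \<in> cycle_graph_verts S a b" using vs nth_mem[OF i] by blast
    have "{xs ! i, xs ! (Suc i mod length xs)} \<in> cyclic_edges xs"
      unfolding cyclic_edges_def using i by blast
    then have "xs ! (Suc i mod length xs) \<in> {third_point S a (xs ! i), third_point S b (xs ! i)}"
      using cycle_edge_iff[OF S ab x] es by blast
    then show "map f xs ! (Suc i mod length (map f xs)) \<in>
      {third_point T (f a) (map f xs ! i), third_point T (f b) (map f xs ! i)}"
      using third[OF ab(1), of "xs ! i"] third[OF ab(2), of "xs ! i"] x i i'
      by (auto simp: cycle_graph_verts_def)
  qed
  let ?s = "\<lambda>S a b xs K. if (a \<in> K \<or> b \<in> K) \<and> K \<inter> set xs \<noteq> {} then transpose a b ` K else K"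
  have mem: "f x \<in> f ` K \<longleftrightarrow> x \<in> K" if "x \<in> points S" "K \<subseteq> points S" for x K
    using that inj by (auto simp: inj_on_def subset_iff)
  have comm: "f ` ?s S a b xs K = ?s T (f a) (f b) (map f xs) (f ` K)" if "K \<in> blocks S" for K
  proof -
    have K: "K \<subseteq> points S" using sts_blockD(1)[OF S that] .
    have "f (transpose a b x) = transpose (f a) (f b) (f x)" if "x \<in> K" for x
      using that K ab inj by (auto simp: transpose_def inj_on_def subset_iff)
    then have "f ` transpose a b ` K = transpose (f a) (f b) ` f ` K"
      by (simp add: image_image cong: image_cong)
    moreover have "f ` K \<inter> set (map f xs) = f ` (K \<inter> set xs)"
      using inj_on_image_Int[OF inj K xsP] by simp
    ultimately show ?thesis using mem[OF ab(1) K] mem[OF ab(2) K] by simp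
  qed
  have "(\<lambda>K. f ` K) ` blocks (cycle_switch S a b xs) =
      blocks (cycle_switch T (f a) (f b) (map f xs))"
    unfolding cycle_switch_blocks[OF S cyc] cycle_switch_blocks[OF T cycT] B[symmetric]
      image_image[of "\<lambda>K. f ` K"] image_image[of _ "\<lambda>K. f ` K"]
    using comm by (rule image_cong[OF refl])
  then show "sts_iso (cycle_switch S a b xs) (cycle_switch T (f a) (f b) (map f xs))"
    unfolding sts_iso_def using f by (intro exI[of _ f]) (simp add: cycle_switch_def)
qed

section \<open>Disconnectedness from an invariant family\<close>

lemma disconnected_if_invariant:
  assumes "C \<in> verts G" "D \<in> verts G" "P C" "\<not> P D"
    and step: "\<And>e. e \<in> arcs G \<Longrightarrow> P (tail G e) \<longleftrightarrow> P (head G e)"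
  shows "disconnected G"
proof -
  have "\<not> connected G"
  proof
    assume "connected G"
    then have "C \<rightarrow>\<^sup>*\<^bsub>with_proj (mk_symmetric G)\<^esub> D"
      using assms(1,2) unfolding connected_def strongly_connected_def by simp
    then have "(C, D) \<in> (arcs_ends (with_proj (mk_symmetric G)))\<^sup>*"
      by (rule reachable_rtranclI)
    then have "P D"
    proof (induction rule: rtrancl_induct)
      case base
      show ?case by (fact assms(3))
    next
      case (step E F)
      then show ?case using assms(5) by (auto simp: parcs_mk_symmetric)
    qed
    with assms(4) show False by contradiction
  qed
  then show ?thesis unfolding disconnected_def using assms(1) by blast
qed

definition has_mixed_pair :: "'a system \<Rightarrow> bool" where
  "has_mixed_pair S \<longleftrightarrow> (\<exists>a b xs ys. is_cycle_in S a b xs \<and> is_cycle_in S a b ys \<and>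
     length xs = 4 \<and> length ys = 6)"

lemma sts_iso_cycle:
  assumes S: "sts v S" and iso: "sts_iso S T"
  obtains f where "\<And>a b xs. is_cycle_in S a b xs \<Longrightarrow>
      is_cycle_in T (f a) (f b) (map f xs) \<and>
      sts_iso (cycle_switch S a b xs) (cycle_switch T (f a) (f b) (map f xs))"
proof -
  obtain f where f: "bij_betw f (points S) (points T)" "(\<lambda>K. f ` K) ` blocks S = blocks T"
    using iso unfolding sts_iso_def by blast
  show thesis
    by (rule that, intro conjI) (rule iso_cycle[OF S f(1) sts_iso_sts[OF S iso] f(2)], assumption)+
qed

lemma has_mixed_pair_iso:
  assumes S: "sts v S" and iso: "sts_iso S T" and "has_mixed_pair S"
  shows "has_mixed_pair T"
proof -
  obtain f where f: "\<And>a b xs. is_cycle_in S a b xs \<Longrightarrow>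
      is_cycle_in T (f a) (f b) (map f xs) \<and>
      sts_iso (cycle_switch S a b xs) (cycle_switch T (f a) (f b) (map f xs))"
    using sts_iso_cycle[OF S iso] by metis
  obtain a b xs ys where "is_cycle_in S a b xs" "is_cycle_in S a b ys" "length xs = 4" "length ys = 6"
    using assms(3) unfolding has_mixed_pair_def by blast
  then show ?thesis unfolding has_mixed_pair_def using f by (metis length_map)
qed

lemma sts_classE:
  assumes "C \<in> sts_classes v" "S \<in> C" "T \<in> C"
  shows "sts v S" "sts v T" "sts_iso S T"
proof -
  have "(S, T) \<in> sts_rel v"
  proof (rule in_quotient_imp_in_rel[OF equiv_sts_rel])
    show "C \<in> {S. sts v S} // sts_rel v" using assms(1) unfolding sts_classes_def .
    show "{S, T} \<subseteq> C" using assms(2,3) by simp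
  qed
  then show "sts v S" "sts v T" "sts_iso S T" by (auto simp: sts_rel_def)
qed

lemma sts_class_self:
  assumes "sts v S"
  shows "sts_rel v `` {S} \<in> sts_classes v" "S \<in> sts_rel v `` {S}"
proof -
  show "sts_rel v `` {S} \<in> sts_classes v"
    unfolding sts_classes_def by (rule quotientI) (simp add: assms)
  show "S \<in> sts_rel v `` {S}" by (simp add: sts_rel_def assms sts_iso_refl)
qed

text \<open>No path leaves the set of classes that meet \<open>\<R>\<close>: an arc may point either way, but
  switching is reversible.  The class of \<open>Z\<close> is not in this set, because having a mixed pair is
  invariant under isomorphism.\<close>

lemma disconnected_by_family:
  fixes \<R> :: "nat system set" and Z :: "nat system"
  assumes fam: "\<And>R. R \<in> \<R> \<Longrightarrow> sts v R"
    and closed: "\<And>R a b xs. R \<in> \<R> \<Longrightarrow> is_cycle_in R a b xs \<Longrightarrow> length xs = l \<Longrightarrow>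
      sts v (cycle_switch R a b xs) \<Longrightarrow> \<exists>R'\<in>\<R>. sts_iso (cycle_switch R a b xs) R'"
    and pure: "\<And>R. R \<in> \<R> \<Longrightarrow> \<not> has_mixed_pair R"
    and R0: "R0 \<in> \<R>" "has_cycle l R0"
    and Z: "sts v Z" "has_mixed_pair Z" "has_cycle l Z"
  shows "disconnected (with_proj (switching_graph l v)) \<and>
    disconnected (reduced_switching_graph l v)"
proof -
  define Q where "Q S \<longleftrightarrow> (\<exists>R\<in>\<R>. sts_iso S R)" for S :: "nat system"
  have Q_iso: "Q T" if "sts v S" "sts_iso S T" "Q S" for S T
    using that sts_iso_sym sts_iso_trans unfolding Q_def by blast
  have Q_switch: "Q T" if S: "sts v S" and T: "sts v T" and "Q S" and "switches_to l S T" for S T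
  proof -
    obtain R where R: "R \<in> \<R>" "sts_iso S R" using \<open>Q S\<close> unfolding Q_def by blast
    obtain a b xs where cyc: "is_cycle_in S a b xs" "length xs = l" "T = cycle_switch S a b xs"
      using \<open>switches_to l S T\<close> unfolding switches_to_def by blast
    obtain f where f: "\<And>a b xs. is_cycle_in S a b xs \<Longrightarrow>
        is_cycle_in R (f a) (f b) (map f xs) \<and>
        sts_iso (cycle_switch S a b xs) (cycle_switch R (f a) (f b) (map f xs))"
      using sts_iso_cycle[OF S R(2)] by metis
    let ?T = "cycle_switch R (f a) (f b) (map f xs)"
    have T': "sts_iso T ?T" using f[OF cyc(1)] cyc(3) by simp
    have "\<exists>R'\<in>\<R>. sts_iso ?T R'"
      using closed[OF R(1), of "f a" "f b" "map f xs"] f[OF cyc(1)] cyc(2) sts_iso_sts[OF T T']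
      by simp
    then show "Q T" unfolding Q_def using sts_iso_trans[OF T'] by blast
  qed
  define P where "P C \<longleftrightarrow> (\<exists>S\<in>C. Q S)" for C
  have P_all: "Q S" if "C \<in> sts_classes v" "P C" "S \<in> C" for C S
    using that sts_classE Q_iso unfolding P_def by metis
  have P_arc: "P D" if C: "C \<in> sts_classes v" "P C" and D: "D \<in> sts_classes v"
    and ST: "S \<in> C" "T \<in> D" "switches_to l S T \<or> switches_to l T S" for C D S T
  proof -
    have "switches_to l S T" using ST(3) switches_to_sym by blast
    then have "Q T"
      using Q_switch[OF sts_classE(1)[OF C(1) ST(1,1)] sts_classE(1)[OF D ST(2,2)] P_all[OF C ST(1)]]
      by blast
    then show ?thesis unfolding P_def using ST(2) by blast
  qed
  let ?C = "sts_rel v `` {R0}" and ?D = "sts_rel v `` {Z}"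
  note CC = sts_class_self[OF fam[OF R0(1)]] and DD = sts_class_self[OF Z(1)]
  have PC: "P ?C" unfolding P_def Q_def using CC(2) R0(1) sts_iso_refl by blast
  have PD: "\<not> P ?D"
  proof
    assume "P ?D"
    then obtain R where "R \<in> \<R>" "sts_iso Z R" using P_all[OF DD(1) _ DD(2)] unfolding Q_def by blast
    then show False using pure has_mixed_pair_iso[OF Z(1) _ Z(2)] by blast
  qed
  have arc: "P C \<longleftrightarrow> P D" if CD: "(C, D) \<in> parcs (switching_graph l v)" for C D
  proof -
    obtain S T where "C \<in> sts_classes v" "D \<in> sts_classes v" "S \<in> C" "T \<in> D"
      "switches_to l S T \<or> switches_to l T S"
      using CD unfolding switching_graph_def by auto
    then show ?thesis using P_arc[of C D S T] P_arc[of D C T S] by blast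
  qed
  have "disconnected (with_proj (switching_graph l v))"
  proof (rule disconnected_if_invariant[where P = P, OF _ _ PC PD])
    show "?C \<in> verts (with_proj (switching_graph l v))" "?D \<in> verts (with_proj (switching_graph l v))"
      using CC(1) DD(1) by (simp_all add: switching_graph_def)
    fix e assume "e \<in> arcs (with_proj (switching_graph l v))"
    then show "P (tail (with_proj (switching_graph l v)) e) \<longleftrightarrow>
        P (head (with_proj (switching_graph l v)) e)"
      using arc[of "fst e" "snd e"] by simp
  qed
  moreover have "disconnected (reduced_switching_graph l v)"
  proof (rule disconnected_if_invariant[where P = P, OF _ _ PC PD])
    show "?C \<in> verts (reduced_switching_graph l v)" "?D \<in> verts (reduced_switching_graph l v)"
      unfolding reduced_switching_graph_def induce_subgraph_verts
      using CC DD R0(2) Z(3) by blast+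
    fix e assume "e \<in> arcs (reduced_switching_graph l v)"
    then show "P (tail (reduced_switching_graph l v) e) \<longleftrightarrow> P (head (reduced_switching_graph l v) e)"
      using arc[of "fst e" "snd e"] unfolding reduced_switching_graph_def by simp
  qed
  ultimately show ?thesis by blast
qed

section \<open>Systems given by Cayley tables\<close>

definition table_system :: "nat list list \<Rightarrow> nat system" where
  "table_system T = ({..<length T},
     {{x, y, T ! x ! y} | x y. x < length T \<and> y < length T \<and> x \<noteq> y})"

text \<open>These are the identities of a Steiner quasigroup.\<close>

definition steiner_table :: "nat list list \<Rightarrow> bool" where
  "steiner_table T \<longleftrightarrow> (\<forall>x\<in>set [0..<length T]. T ! x ! x = x \<and>
     (\<forall>y\<in>set [0..<length T]. T ! x ! y < length T \<and> T ! x ! y = T ! y ! x \<and>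
        T ! x ! (T ! x ! y) = y))"

lemma steiner_tableD:
  assumes "steiner_table T" "x < length T" "y < length T"
  shows "T ! x ! x = x" "T ! x ! y < length T" "T ! x ! y = T ! y ! x" "T ! x ! (T ! x ! y) = y"
  using assms by (auto simp: steiner_table_def)

lemma steiner_table_neq:
  assumes "steiner_table T" "x < length T" "y < length T" "x \<noteq> y"
  shows "T ! x ! y \<noteq> x" "T ! x ! y \<noteq> y"
  using steiner_tableD[OF assms(1-3)] steiner_tableD[OF assms(1,3,2)] assms(4) by metis+

lemma table_block:
  assumes "x < length T" "y < length T" "x \<noteq> y"
  shows "{x, y, T ! x ! y} \<in> blocks (table_system T)"
  using assms by (auto simp: table_system_def)

lemma table_block_eq:
  assumes T: "steiner_table T" and K: "K \<in> blocks (table_system T)"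
    and x: "x \<in> K" "y \<in> K" "x \<noteq> y"
  shows "K = {x, y, T ! x ! y}"
proof -
  obtain p q where pq: "p < length T" "q < length T" "K = {p, q, T ! p ! q}"
    using K by (auto simp: table_system_def)
  let ?r = "T ! p ! q"
  have "T ! q ! p = ?r" "T ! p ! ?r = q" "T ! ?r ! p = q" "T ! q ! ?r = p" "T ! ?r ! q = p"
    using steiner_tableD[OF T] pq(1,2) by metis+
  then show ?thesis using x unfolding pq(3) by (elim insertE emptyE) (simp_all add: insert_commute)
qed

lemma sts_table_system:
  assumes T: "steiner_table T"
  shows "sts (length T) (table_system T)"
proof -
  have P: "points (table_system T) = {..<length T}" by (simp add: table_system_def)
  have "K \<subseteq> {..<length T} \<and> card K = 3" if "K \<in> blocks (table_system T)" for K
  proof -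
    obtain p q where "p < length T" "q < length T" "p \<noteq> q" "K = {p, q, T ! p ! q}"
      using \<open>K \<in> blocks (table_system T)\<close> by (auto simp: table_system_def)
    then show ?thesis
      using steiner_tableD(2)[OF T, of p q] steiner_table_neq[OF T, of p q] by auto
  qed
  moreover have "\<exists>!K. K \<in> blocks (table_system T) \<and> {x, y} \<subseteq> K"
    if "x < length T" "y < length T" "x \<noteq> y" for x y
  proof (rule ex1I[of _ "{x, y, T ! x ! y}"])
    show "{x, y, T ! x ! y} \<in> blocks (table_system T) \<and> {x, y} \<subseteq> {x, y, T ! x ! y}"
      using table_block[OF that] by simp
    fix K assume "K \<in> blocks (table_system T) \<and> {x, y} \<subseteq> K"
    then show "K = {x, y, T ! x ! y}" using table_block_eq[OF T, of K x y] that(3) by simp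
  qed
  then have "\<forall>x\<in>{..<length T}. \<forall>y\<in>{..<length T}. x \<noteq> y \<longrightarrow>
      (\<exists>!K. K \<in> blocks (table_system T) \<and> {x, y} \<subseteq> K)"
    by (intro ballI impI) (simp only: lessThan_iff)
  ultimately show ?thesis unfolding sts_def P by (intro conjI ballI) simp_all
qed

lemma table_third_point:
  assumes "steiner_table T" "x < length T" "y < length T" "x \<noteq> y"
  shows "third_point (table_system T) x y = T ! x ! y"
  by (rule third_point_eq[OF sts_table_system[OF assms(1)] table_block[OF assms(2-4)]])

text \<open>The lists \<open>r\<close> and \<open>s\<close> stand for the rows of \<open>a\<close> and \<open>b\<close>, which give the edges of the
  cycle graph; the natural number only bounds the recursion.\<close>

fun trace :: "nat list \<Rightarrow> nat list \<Rightarrow> nat \<Rightarrow> nat \<Rightarrow> nat \<Rightarrow> nat list" where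
  "trace r s start 0 x = []"
| "trace r s start (Suc k) x = x # r ! x #
     (if s ! (r ! x) = start then [] else trace r s start k (s ! (r ! x)))"

fun trace_all :: "nat list \<Rightarrow> nat list \<Rightarrow> nat \<Rightarrow> nat list \<Rightarrow> nat list list" where
  "trace_all r s 0 xs = []"
| "trace_all r s (Suc k) [] = []"
| "trace_all r s (Suc k) (x # xs) =
     trace r s x k x # trace_all r s k (filter (\<lambda>y. y \<notin> set (trace r s x k x)) xs)"

lemma trace_numeral:
  "trace r s start (numeral k) x = x # r ! x #
     (if s ! (r ! x) = start then [] else trace r s start (pred_numeral k) (s ! (r ! x)))"
  "trace_all r s (numeral k) [] = []"
  "trace_all r s (numeral k) (x # xs) =
     trace r s x (pred_numeral k) x #
       trace_all r s (pred_numeral k) (filter (\<lambda>y. y \<notin> set (trace r s x (pred_numeral k) x)) xs)"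
  by (simp_all add: numeral_eq_Suc)

definition table_cycles :: "nat list list \<Rightarrow> nat \<Rightarrow> nat \<Rightarrow> nat list list" where
  "table_cycles T a b = trace_all (T ! a) (T ! b) (length T)
     (filter (\<lambda>x. x \<noteq> a \<and> x \<noteq> b \<and> x \<noteq> T ! a ! b) [0..<length T])"

definition cyclic_walk :: "nat list \<Rightarrow> nat list \<Rightarrow> nat list \<Rightarrow> bool" where
  "cyclic_walk r s c \<longleftrightarrow>
     3 \<le> length c \<and> distinct c \<and> (\<forall>(x, y)\<in>set (zip c (rotate1 c)). y = r ! x \<or> y = s ! x)"

text \<open>Tracing needs no correctness proof: a list \<open>cs\<close>, however it was found, contains all cycles
  of \<open>a\<close> and \<open>b\<close> up to order of the vertices once its entries are cycles that exhaust
  the vertices of the cycle graph.\<close>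

definition cycles_verified :: "nat list list \<Rightarrow> nat \<Rightarrow> nat \<Rightarrow> nat list list \<Rightarrow> bool" where
  "cycles_verified T a b cs \<longleftrightarrow>
     (\<forall>c\<in>set cs. cyclic_walk (T ! a) (T ! b) c \<and>
        (\<forall>x\<in>set c. x < length T \<and> x \<noteq> a \<and> x \<noteq> b \<and> x \<noteq> T ! a ! b)) \<and>
     (\<forall>x\<in>set [0..<length T]. x = a \<or> x = b \<or> x = T ! a ! b \<or>
        (\<exists>c\<in>set cs. x \<in> set c))"

lemma cyclic_walk_is_cycle:
  assumes S: "sts v S" and ab: "a \<in> points S" "b \<in> points S" "a \<noteq> b"
    and walk: "cyclic_walk r s c" and c: "set c \<subseteq> cycle_graph_verts S a b"
    and rows: "\<And>x. x \<in> set c \<Longrightarrow> third_point S a x = r ! x"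
      "\<And>x. x \<in> set c \<Longrightarrow> third_point S b x = s ! x"
  shows "is_cycle_in S a b c"
proof (rule is_cycle_inI[OF S ab _ _ c])
  show "3 \<le> length c" "distinct c" using walk by (simp_all add: cyclic_walk_def)
  fix i assume i: "i < length c"
  have "(c ! i, c ! (Suc i mod length c)) \<in> set (zip c (rotate1 c))"
    using i by (auto simp: in_set_zip nth_rotate1 intro!: exI[of _ i])
  then have "c ! (Suc i mod length c) = r ! (c ! i) \<or> c ! (Suc i mod length c) = s ! (c ! i)"
    using walk unfolding cyclic_walk_def by blast
  then show "c ! (Suc i mod length c) \<in> {third_point S a (c ! i), third_point S b (c ! i)}"
    using rows[of "c ! i"] i by auto
qed

text \<open>Stated for any system that agrees with the table on the rows of \<open>a\<close> and \<open>b\<close>, as those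
  rows already determine the cycle graph.\<close>

lemma verified_cycles:
  assumes S: "sts v S" and P: "points S = {..<length T}"
    and ab: "a < length T" "b < length T" "a \<noteq> b"
    and rows: "\<And>x. x < length T \<Longrightarrow> x \<noteq> a \<Longrightarrow> third_point S a x = T ! a ! x"
      "\<And>x. x < length T \<Longrightarrow> x \<noteq> b \<Longrightarrow> third_point S b x = T ! b ! x"
    and ver: "cycles_verified T a b cs"
  shows "c \<in> set cs \<Longrightarrow> is_cycle_in S a b c"
    and "is_cycle_in S a b xs \<Longrightarrow>
      \<exists>c\<in>set cs. is_cycle_in S a b c \<and> set xs = set c \<and> length xs = length c"
proof -
  have verts: "cycle_graph_verts S a b = {x. x < length T \<and> x \<noteq> a \<and> x \<noteq> b \<and> x \<noteq> T ! a ! b}"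
    using rows(1)[of b] ab unfolding cycle_graph_verts_def P by auto
  have ab': "a \<in> points S" "b \<in> points S" using ab P by simp_all
  have cyc: "is_cycle_in S a b c" if c: "c \<in> set cs" for c
  proof (rule cyclic_walk_is_cycle[OF S ab' ab(3)])
    show "cyclic_walk (T ! a) (T ! b) c" "set c \<subseteq> cycle_graph_verts S a b"
      using ver c unfolding cycles_verified_def verts by auto
    then show "third_point S a x = T ! a ! x" "third_point S b x = T ! b ! x" if "x \<in> set c" for x
      using rows that unfolding verts by auto
  qed
  then show "c \<in> set cs \<Longrightarrow> is_cycle_in S a b c" .
  assume xs: "is_cycle_in S a b xs"
  then have "xs \<noteq> []" "set xs \<subseteq> cycle_graph_verts S a b" by (auto simp: is_cycle_in_def)
  then obtain x where x: "x \<in> set xs" "x \<in> cycle_graph_verts S a b" by (cases xs) auto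
  then obtain c where c: "c \<in> set cs" "x \<in> set c"
    using ver unfolding cycles_verified_def verts by auto
  from cycles_meet_eq[OF S xs cyc[OF c(1)] x(1) c(2)] have "set xs = set c" .
  then show "\<exists>c\<in>set cs. is_cycle_in S a b c \<and> set xs = set c \<and> length xs = length c"
    using c(1) cyc[OF c(1)] cycle_length_card[OF xs] cycle_length_card[OF cyc[OF c(1)]] by auto
qed

definition maps_block :: "nat list list \<Rightarrow> nat list \<Rightarrow> nat \<Rightarrow> nat \<Rightarrow> nat \<Rightarrow> bool" where
  "maps_block T f x y z \<longleftrightarrow> T ! (f ! x) ! (f ! y) = f ! z"

text \<open>The permutation \<open>f\<close>, given as the list of its values, carries every block of the switched
  system to a block.  The blocks are enumerated through their pairs \<open>x < y\<close>; a block that is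
  moved by the switch is replaced by its image under the transposition.  The conditionals, in
  place of implications, spare the simplifier the cases that do not arise.\<close>

definition switch_iso :: "nat list list \<Rightarrow> nat \<Rightarrow> nat \<Rightarrow> nat list \<Rightarrow> nat list list \<Rightarrow> nat list \<Rightarrow> bool" where
  "switch_iso T a b c T' f \<longleftrightarrow> length f = length T \<and> distinct f \<and> (\<forall>x\<in>set f. x < length T) \<and>
     (\<forall>y\<in>set [0..<length T]. \<forall>x\<in>set [0..<length T]. if x < y then
        if (a \<in> {x, y, T ! x ! y} \<or> b \<in> {x, y, T ! x ! y}) \<and>
          (x \<in> set c \<or> y \<in> set c \<or> T ! x ! y \<in> set c)
        then maps_block T' f (transpose a b x) (transpose a b y) (transpose a b (T ! x ! y))
        else maps_block T' f x y (T ! x ! y)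
      else True)"

lemma switch_iso_sound:
  assumes T: "steiner_table T" and T': "steiner_table T'" "length T' = length T"
    and cyc: "is_cycle_in (table_system T) a b c"
    and sts: "sts (length T) (cycle_switch (table_system T) a b c)"
    and iso: "switch_iso T a b c T' f"
  shows "sts_iso (cycle_switch (table_system T) a b c) (table_system T')"
proof (rule sts_isoI[OF sts])
  let ?n = "length T" and ?S = "table_system T"
  show "sts ?n (table_system T')" using sts_table_system[OF T'(1)] T'(2) by simp
  have f: "length f = ?n" "distinct f" "\<And>x. x \<in> set f \<Longrightarrow> x < ?n"
    using iso by (auto simp: switch_iso_def)
  have inj: "inj_on ((!) f) {..<?n}" using f(1,2) by (auto simp: inj_on_def nth_eq_iff_index_eq)
  have im: "(!) f ` {..<?n} \<subseteq> {..<?n}" using f(1,3) by auto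
  then have "(!) f ` {..<?n} = {..<?n}" using inj by (intro card_subset_eq) (simp_all add: card_image)
  then show "bij_betw ((!) f) (points (cycle_switch ?S a b c)) (points (table_system T'))"
    using inj T'(2) by (simp add: bij_betw_def cycle_switch_def table_system_def)
  fix K assume "K \<in> blocks (cycle_switch ?S a b c)"
  then obtain L where L: "L \<in> blocks ?S"
    and K: "K = (if (a \<in> L \<or> b \<in> L) \<and> L \<inter> set c \<noteq> {} then transpose a b ` L else L)"
    unfolding cycle_switch_blocks[OF sts_table_system[OF T] cyc] by blast
  obtain p q where pq: "p < ?n" "q < ?n" "p \<noteq> q" "L = {p, q, T ! p ! q}"
    using L by (auto simp: table_system_def)
  define x y where "x = min p q" and "y = max p q"
  have xy: "x < y" "y < ?n" "L = {x, y, T ! x ! y}"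
    using pq steiner_tableD(3)[OF T pq(1,2)] by (auto simp: x_def y_def min_def max_def)
  let ?z = "T ! x ! y"
  define h where "h = (if (a \<in> L \<or> b \<in> L) \<and> L \<inter> set c \<noteq> {} then transpose a b else id)"
  have K': "K = {h x, h y, h ?z}" unfolding K h_def xy(3) by simp
  have meets: "(x \<in> set c \<or> y \<in> set c \<or> ?z \<in> set c) \<longleftrightarrow> L \<inter> set c \<noteq> {}"
    unfolding xy(3) by auto
  have "maps_block T' f (h x) (h y) (h ?z)"
    using iso xy(1,2) meets unfolding switch_iso_def h_def xy(3) by auto
  have "K \<subseteq> points (cycle_switch ?S a b c)" "card K = 3"
    using sts_blockD[OF sts \<open>K \<in> blocks (cycle_switch ?S a b c)\<close>] by auto
  then have "h x < ?n" "h y < ?n" "h x \<noteq> h y"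
    unfolding K' by (auto simp: cycle_switch_def table_system_def card_insert_if split: if_splits)
  then have "f ! h x < ?n" "f ! h y < ?n" "f ! h x \<noteq> f ! h y"
    using f by (auto simp: nth_eq_iff_index_eq)
  with \<open>maps_block T' f (h x) (h y) (h ?z)\<close> show "(!) f ` K \<in> blocks (table_system T')"
    using table_block[of "f ! h x" T' "f ! h y"] T'(2) K'
    by (simp add: maps_block_def)
qed

text \<open>Both \<open>f\<close> and \<open>f\<close> preceded by the transposition of \<open>a\<close> and \<open>b\<close> are tried, since
  switching the complementary part of a cycle graph has the same effect as switching a
  cycle, followed by that transposition.\<close>

definition pair_closed ::
    "nat list list \<Rightarrow> nat list \<Rightarrow> nat list list \<Rightarrow> nat list \<Rightarrow> nat \<Rightarrow> nat \<Rightarrow> nat list list \<Rightarrow> bool" where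
  "pair_closed T ls T' f a b cs \<longleftrightarrow> cycles_verified T a b cs \<and>
     (4 \<in> length ` set cs \<longrightarrow> 6 \<notin> length ` set cs) \<and>
     (\<forall>c\<in>set cs. if length c \<in> set ls then if switch_iso T a b c T' f then True
        else switch_iso T a b c T' (map (\<lambda>x. f ! transpose a b x) [0..<length T]) else True)"

definition table_closed :: "nat list list \<Rightarrow> nat list \<Rightarrow> nat list list \<Rightarrow> nat list \<Rightarrow> bool" where
  "table_closed T ls T' f \<longleftrightarrow>
     (\<forall>b\<in>set [0..<length T]. \<forall>a\<in>set [0..<length T]. if a < b
        then pair_closed T ls T' f a b (table_cycles T a b) else True)"

text \<open>As a congruence rule this keeps the simplifier from working on the body of a bounded
  quantifier before the bound variable has been instantiated.\<close>

lemma Ball_weak_cong: "A = B \<Longrightarrow> Ball A P = Ball B P"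
  by simp

lemma sts_cycle_less:
  assumes "sts v S" "is_cycle_in S a b xs"
  obtains d e :: nat where "d < e" "is_cycle_in S d e xs"
    "cycle_switch S a b xs = cycle_switch S d e xs"
proof (cases "a < b")
  case True
  then show thesis using that[of a b] assms(2) by simp
next
  case False
  moreover have "a \<noteq> b" using assms(2) by (simp add: is_cycle_in_def)
  ultimately have "b < a" by simp
  then show thesis
    using that[of b a] is_cycle_in_commute[OF assms] cycle_switch_commute[of S a b xs]
    by simp
qed

lemma table_cycle_exists:
  assumes T: "steiner_table T" and ab: "a < length T" "b < length T" "a \<noteq> b"
    and ver: "cycles_verified T a b cs" and l: "l \<in> length ` set cs"
  obtains c where "is_cycle_in (table_system T) a b c" "length c = l"
proof -
  obtain c where c: "c \<in> set cs" "length c = l" using l by blast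
  have "is_cycle_in (table_system T) a b c"
    by (rule verified_cycles(1)[OF sts_table_system[OF T] _ ab _ _ ver c(1)])
      (simp_all add: table_system_def table_third_point[OF T, unfolded table_system_def] ab)
  then show thesis using c(2) that by blast
qed

lemma table_closed_cycle:
  assumes T: "steiner_table T" and closed: "table_closed T ls T' f"
    and cyc: "is_cycle_in (table_system T) a b xs" and ab: "a < b"
  obtains c where "pair_closed T ls T' f a b (table_cycles T a b)" "c \<in> set (table_cycles T a b)"
    "is_cycle_in (table_system T) a b c" "set xs = set c" "length xs = length c"
proof -
  have lt: "a < length T" "b < length T" "a \<noteq> b"
    using cyc ab by (auto simp: is_cycle_in_def table_system_def)
  have pc: "pair_closed T ls T' f a b (table_cycles T a b)"
    using closed lt ab by (auto simp: table_closed_def)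
  then have ver: "cycles_verified T a b (table_cycles T a b)" by (simp add: pair_closed_def)
  have "\<exists>c\<in>set (table_cycles T a b). is_cycle_in (table_system T) a b c \<and>
      set xs = set c \<and> length xs = length c"
    by (rule verified_cycles(2)[OF sts_table_system[OF T] _ lt _ _ ver cyc])
      (simp_all add: table_system_def table_third_point[OF T, unfolded table_system_def] lt)
  then show thesis using that[OF pc] by blast
qed

lemma table_closed_switch:
  assumes T: "steiner_table T" and T': "steiner_table T'" "length T' = length T"
    and closed: "table_closed T ls T' f"
    and cyc: "is_cycle_in (table_system T) a b xs" "length xs \<in> set ls"
    and sts: "sts (length T) (cycle_switch (table_system T) a b xs)"
  shows "sts_iso (cycle_switch (table_system T) a b xs) (table_system T')"
proof -
  let ?S = "table_system T"
  obtain d e where de: "d < e" and cyc': "is_cycle_in ?S d e xs"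
    and sw: "cycle_switch ?S a b xs = cycle_switch ?S d e xs"
    using sts_cycle_less[OF sts_table_system[OF T] cyc(1)] by metis
  obtain c where c: "pair_closed T ls T' f d e (table_cycles T d e)"
    "c \<in> set (table_cycles T d e)" "is_cycle_in ?S d e c" "set xs = set c" "length xs = length c"
    using table_closed_cycle[OF T closed cyc' de] by metis
  have sw': "cycle_switch ?S a b xs = cycle_switch ?S d e c"
    unfolding sw by (rule cycle_switch_cong[OF sts_table_system[OF T] cyc' c(3,4)])
  have "\<exists>f. switch_iso T d e c T' f"
    using c(1,2,5) cyc(2) unfolding pair_closed_def by (metis (full_types))
  then show ?thesis
    using switch_iso_sound[OF T T' c(3)] sts unfolding sw' by blast
qed

lemma table_closed_pure:
  assumes T: "steiner_table T" and closed: "table_closed T ls T' f"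
  shows "\<not> has_mixed_pair (table_system T)"
proof
  let ?S = "table_system T"
  note S = sts_table_system[OF T]
  assume "has_mixed_pair ?S"
  then obtain a b xs ys where *: "is_cycle_in ?S a b xs" "is_cycle_in ?S a b ys"
    "length xs = 4" "length ys = 6"
    unfolding has_mixed_pair_def by blast
  have "\<exists>d e. d < e \<and> is_cycle_in ?S d e xs \<and> is_cycle_in ?S d e ys"
  proof (cases "a < b")
    case False
    moreover have "a \<noteq> b" using *(1) by (simp add: is_cycle_in_def)
    ultimately have "b < a" by simp
    then show ?thesis using is_cycle_in_commute[OF S *(1)] is_cycle_in_commute[OF S *(2)] by blast
  qed (use * in blast)
  then obtain d e where de: "d < e" "is_cycle_in ?S d e xs" "is_cycle_in ?S d e ys" by blast
  obtain c where c: "pair_closed T ls T' f d e (table_cycles T d e)"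
    "c \<in> set (table_cycles T d e)" "length xs = length c"
    using table_closed_cycle[OF T closed de(2,1)] by metis
  obtain c' where c': "c' \<in> set (table_cycles T d e)" "length ys = length c'"
    using table_closed_cycle[OF T closed de(3,1)] by metis
  have "4 \<in> length ` set (table_cycles T d e)" "6 \<in> length ` set (table_cycles T d e)"
    using c c' *(3,4) by force+
  then show False using c(1) by (simp add: pair_closed_def)
qed

text \<open>The only block through \<open>a\<close> or \<open>b\<close> that the switch leaves alone is the one through both,
  and this block is invariant under the transposition of \<open>a\<close> and \<open>b\<close>.\<close>

lemma hamiltonian_switch:
  assumes S: "sts v S" and cyc: "is_cycle_in S a b xs" and l: "length xs = v - 3"
    and sts: "sts v (cycle_switch S a b xs)"
  shows "sts_iso (cycle_switch S a b xs) S"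
proof (rule sts_isoI[OF sts S, where f = "transpose a b"])
  have ab: "a \<in> points S" "b \<in> points S" "a \<noteq> b" and vs: "set xs \<subseteq> cycle_graph_verts S a b"
    using cyc by (auto simp: is_cycle_in_def)
  let ?c = "third_point S a b"
  note c = third_point_props[OF S ab]
  have "card (cycle_graph_verts S a b) = v - 3"
    using sts_points[OF S] c(1-3) ab unfolding cycle_graph_verts_def
    by (subst card_Diff_subset) (auto simp: card_insert_if)
  then have X: "set xs = cycle_graph_verts S a b"
    using vs l cycle_length_card[OF cyc] sts_points(1)[OF S]
    by (intro card_subset_eq) (auto simp: cycle_graph_verts_def)
  show "bij_betw (transpose a b) (points (cycle_switch S a b xs)) (points S)"
    using ab by (simp add: cycle_switch_def bij_betw_transpose_iff)
  fix K assume "K \<in> blocks (cycle_switch S a b xs)"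
  then obtain L where L: "L \<in> blocks S"
    and K: "K = (if (a \<in> L \<or> b \<in> L) \<and> L \<inter> set xs \<noteq> {} then transpose a b ` L else L)"
    unfolding cycle_switch_blocks[OF S cyc] by blast
  show "transpose a b ` K \<in> blocks S"
  proof (cases "(a \<in> L \<or> b \<in> L) \<and> L \<inter> set xs \<noteq> {}")
    case True
    then have "transpose a b ` K = L" unfolding K by (simp add: image_image)
    then show ?thesis using L by simp
  next
    case False
    have "transpose a b ` L = L"
    proof (cases "a \<in> L \<or> b \<in> L")
      case True
      then have "L \<subseteq> {a, b, ?c}"
        using False X sts_blockD(1)[OF S L] by (auto simp: cycle_graph_verts_def)
      moreover have "card {a, b, ?c} = 3" using ab c(2,3) by (simp add: card_insert_if)
      ultimately have "L = {a, b, ?c}"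
        using sts_blockD(2)[OF S L] by (intro card_subset_eq) simp_all
      then show ?thesis using c(2,3) by (auto simp: transpose_def)
    next
      case False
      then show ?thesis by (force simp: transpose_def image_iff)
    qed
    then show ?thesis using L False unfolding K by simp
  qed
qed

section \<open>Systems with a prescribed one-factorisation\<close>

lemma even_card_involution:
  assumes "finite A" and f: "\<And>x. x \<in> A \<Longrightarrow> f x \<in> A" "\<And>x. x \<in> A \<Longrightarrow> f x \<noteq> x"
    "\<And>x. x \<in> A \<Longrightarrow> f (f x) = x"
  shows "even (card A)"
proof -
  have U: "\<Union> ((\<lambda>x. {x, f x}) ` A) = A" using f(1) by blast
  have "2 dvd card (\<Union> ((\<lambda>x. {x, f x}) ` A))"
  proof (rule dvd_partition)
    show "finite (\<Union> ((\<lambda>x. {x, f x}) ` A))" unfolding U by (fact assms(1))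
    show "\<forall>c\<in>(\<lambda>x. {x, f x}) ` A. 2 dvd card c"
    proof
      fix c assume "c \<in> (\<lambda>x. {x, f x}) ` A"
      then obtain x where x: "x \<in> A" "c = {x, f x}" by blast
      then have "x \<noteq> f x" using f(2)[of x] by simp
      then show "2 dvd card c" using x(2) by simp
    qed
    show "\<forall>c1\<in>(\<lambda>x. {x, f x}) ` A. \<forall>c2\<in>(\<lambda>x. {x, f x}) ` A. c1 \<noteq> c2 \<longrightarrow> c1 \<inter> c2 = {}"
      using f(3) by (auto, metis+)
  qed
  then show ?thesis unfolding U by simp
qed

text \<open>The points below 10 are the outer ones.  A block that meets them has two outer points
  and one inner point, the factor containing the edge between the two
  (\<open>frame_split\<close>); the subsystem on the inner points is left open.\<close>

definition frame_family :: "nat list list \<Rightarrow> nat system set" where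
  "frame_family T = {S. sts 19 S \<and> points S = {..<19} \<and>
     {K \<in> blocks (table_system T). K \<inter> {..<10} \<noteq> {}} \<subseteq> blocks S}"

definition frame_split :: "nat list list \<Rightarrow> bool" where
  "frame_split T \<longleftrightarrow> (\<forall>u\<in>set [0..<10]. \<forall>x\<in>set [0..<19]. u = x \<or> (T ! u ! x < 10 \<longleftrightarrow> 10 \<le> x))"

definition frame_outer :: "nat list list \<Rightarrow> bool" where
  "frame_outer T \<longleftrightarrow> (\<forall>b\<in>set [0..<10]. \<forall>a\<in>set [0..<10]. if a < b
     then cycles_verified T a b (table_cycles T a b) \<and>
       6 \<notin> length ` set (table_cycles T a b) \<and> 10 \<notin> length ` set (table_cycles T a b)
     else True)"

definition spans_outer :: "nat list \<Rightarrow> nat list \<Rightarrow> nat list \<Rightarrow> bool" where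
  "spans_outer r s c \<longleftrightarrow> cyclic_walk r s c \<and> (\<forall>x\<in>set c. x < 10) \<and> (\<forall>x\<in>set [0..<10]. x \<in> set c)"

text \<open>The union of two factors is traced from the outer point 0.\<close>

definition frame_perfect :: "nat list list \<Rightarrow> bool" where
  "frame_perfect T \<longleftrightarrow> (\<forall>b\<in>set [10..<19]. \<forall>a\<in>set [10..<19]. if a < b
     then spans_outer (T ! a) (T ! b) (trace (T ! a) (T ! b) 0 19 0) else True)"

locale frame =
  fixes T :: "nat list list"
  assumes T: "steiner_table T" and len: "length T = 19"
    and split: "frame_split T" and outer: "frame_outer T" and perfect: "frame_perfect T"
begin

lemma in_family: "table_system T \<in> frame_family T"
  using sts_table_system[OF T] by (auto simp: frame_family_def len table_system_def)

lemma family_sts: "S \<in> frame_family T \<Longrightarrow> sts 19 S" "S \<in> frame_family T \<Longrightarrow> points S = {..<19}"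
  by (simp_all add: frame_family_def)

lemma frame_block:
  assumes "S \<in> frame_family T" "u < 10" "x < 19" "u \<noteq> x"
  shows "{u, x, T ! u ! x} \<in> blocks S"
proof -
  have "{u, x, T ! u ! x} \<in> blocks (table_system T)" using table_block[of u T x] assms len by simp
  then show ?thesis using assms unfolding frame_family_def by auto
qed

lemma frame_third:
  assumes "S \<in> frame_family T" "u < 10" "x < 19" "u \<noteq> x"
  shows "third_point S u x = T ! u ! x" "third_point S x u = T ! x ! u"
proof -
  show "third_point S u x = T ! u ! x"
    by (rule third_point_eq[OF family_sts(1)[OF assms(1)] frame_block[OF assms]])
  then show "third_point S x u = T ! x ! u"
    using third_point_props(4)[OF family_sts(1)[OF assms(1)], of u x] assms family_sts(2)[OF assms(1)]
      steiner_tableD(3)[OF T, of u x] len by simp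
qed

lemma table_split: "u < 10 \<Longrightarrow> x < 19 \<Longrightarrow> u \<noteq> x \<Longrightarrow> T ! u ! x < 10 \<longleftrightarrow> 10 \<le> x"
  using split unfolding frame_split_def set_upt by (meson atLeastLessThan_iff le0)

lemma split_iff:
  assumes "S \<in> frame_family T" "u < 10" "x < 19" "u \<noteq> x"
  shows "third_point S u x < 10 \<longleftrightarrow> 10 \<le> x"
  unfolding frame_third(1)[OF assms] by (rule table_split[OF assms(2-4)])

lemma inner_closed:
  assumes S: "S \<in> frame_family T" and "10 \<le> x" "x < 19" "10 \<le> y" "y < 19" "x \<noteq> y"
  shows "10 \<le> third_point S x y"
proof (rule ccontr)
  let ?u = "third_point S x y"
  assume u: "\<not> 10 \<le> ?u"
  have xy: "x \<in> points S" "y \<in> points S" using assms family_sts(2)[OF S] by simp_all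
  note p = third_point_props[OF family_sts(1)[OF S] xy \<open>x \<noteq> y\<close>]
  have "third_point S ?u x = third_point S x ?u"
    using third_point_props(4)[OF family_sts(1)[OF S] xy(1) p(1)] p(2) by simp
  then have "third_point S ?u x = y" using p(5) by simp
  then show False using split_iff[OF S, of ?u x] u assms by simp
qed

lemma outer_pair:
  assumes S: "S \<in> frame_family T" and cyc: "is_cycle_in S a b xs" and ab: "a < b" "b < 10"
  shows "length xs \<noteq> 6" "length xs \<noteq> 10"
proof -
  let ?cs = "table_cycles T a b"
  have ver: "cycles_verified T a b ?cs" and no: "6 \<notin> length ` set ?cs" "10 \<notin> length ` set ?cs"
    using bspec[OF bspec[OF outer[unfolded frame_outer_def]], of b a] ab
    unfolding set_upt atLeastLessThan_iff by simp_all
  have "\<exists>c\<in>set ?cs. is_cycle_in S a b c \<and> set xs = set c \<and> length xs = length c"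
    by (rule verified_cycles(2)[OF family_sts(1)[OF S] _ _ _ _ _ _ ver cyc])
      (use ab frame_third(1)[OF S] family_sts(2)[OF S] len in auto)
  then show "length xs \<noteq> 6" "length xs \<noteq> 10" using no by force+
qed

text \<open>The edges coming from \<open>a\<close> join inner to outer vertices and those coming from \<open>b\<close> never
  do.  Hence a cycle has equally many inner and outer vertices, and the edges from \<open>b\<close> match
  its inner vertices in pairs.\<close>

lemma mixed_pair:
  assumes S: "S \<in> frame_family T" and cyc: "is_cycle_in S a b xs"
    and ab: "a < 10" "10 \<le> b"
  shows "4 dvd length xs"
proof -
  note sts = family_sts(1)[OF S]
  let ?ta = "third_point S a" and ?tb = "third_point S b"
  define I where "I = {x \<in> set xs. 10 \<le> x}"
  define J where "J = {x \<in> set xs. x < 10}"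
  have abp: "a \<in> points S" "b \<in> points S" "a \<noteq> b" and vs: "set xs \<subseteq> cycle_graph_verts S a b"
    using cyc by (auto simp: is_cycle_in_def)
  have x: "x \<in> points S" "x < 19" "a \<noteq> x" "b \<noteq> x" if "x \<in> set xs" for x
    using vs that family_sts(2)[OF S] by (auto simp: cycle_graph_verts_def)
  note cl = cycle_closed[OF sts cyc]
  have inv: "?ta (?ta x) = x" "?tb (?tb x) = x" "?tb x \<noteq> x" if "x \<in> set xs" for x
    using third_point_props[OF sts abp(1) x(1,3)[OF that]]
      third_point_props[OF sts abp(2) x(1,4)[OF that]] by simp_all
  have flip: "?ta x < 10 \<longleftrightarrow> 10 \<le> x" if "x \<in> set xs" for x
    using split_iff[OF S ab(1) x(2,3)[OF that]] .
  have "?ta ` I \<subseteq> J" "?ta ` J \<subseteq> I" using flip cl(1) unfolding I_def J_def by force+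
  then have "bij_betw ?ta I J"
    using inv(1) by (intro bij_betw_byWitness[where f' = ?ta]) (auto simp: I_def J_def)
  then have "card I = card J" by (rule bij_betw_same_card)
  moreover have "card (set xs) = card I + card J"
    unfolding I_def J_def by (subst card_Un_disjoint[symmetric]) (auto intro: arg_cong[of _ _ card])
  moreover have "even (card I)"
  proof (rule even_card_involution)
    show "finite I" by (simp add: I_def)
    fix x assume "x \<in> I"
    then have xs: "x \<in> set xs" "10 \<le> x" by (auto simp: I_def)
    show "?tb x \<in> I"
      using inner_closed[OF S ab(2) _ xs(2) x(2)[OF xs(1)] x(4)[OF xs(1)]] abp(2) cl(2)[OF xs(1)]
        family_sts(2)[OF S] by (simp add: I_def)
    show "?tb x \<noteq> x" "?tb (?tb x) = x" using inv xs(1) by simp_all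
  qed
  ultimately have "card (set xs) = 2 * card I" "2 dvd card I" by simp_all
  then show ?thesis unfolding cycle_length_card[OF cyc] by (auto elim!: dvdE)
qed

text \<open>The cycle through the outer point 0 already uses up all outer points.\<close>

lemma inner_pair:
  assumes S: "S \<in> frame_family T" and cyc: "is_cycle_in S a b xs" and ab: "10 \<le> a" "a < b"
  shows "set xs = {..<10} \<or> set xs \<inter> {..<10} = {}"
proof (rule disjCI)
  assume "set xs \<inter> {..<10} \<noteq> {}"
  then obtain x where x: "x \<in> set xs" "x < 10" by auto
  note sts = family_sts(1)[OF S]
  let ?c = "trace (T ! a) (T ! b) 0 19 0"
  have abp: "a \<in> points S" "b \<in> points S" "a \<noteq> b" using cyc by (auto simp: is_cycle_in_def)
  then have b: "b < 19" using family_sts(2)[OF S] by simp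
  have "spans_outer (T ! a) (T ! b) ?c" 
    using bspec[OF bspec[OF perfect[unfolded frame_perfect_def]], of b a] ab b
    unfolding set_upt atLeastLessThan_iff by simp
  then have walk: "cyclic_walk (T ! a) (T ! b) ?c" and c: "set ?c = {..<10}"
    by (auto simp: spans_outer_def)
  have "is_cycle_in S a b ?c"
  proof (rule cyclic_walk_is_cycle[OF sts abp walk])
    show "set ?c \<subseteq> cycle_graph_verts S a b"
      using c ab b family_sts(2)[OF S] inner_closed[OF S ab(1) _ _ b] abp(3)
      by (force simp: cycle_graph_verts_def)
    show "third_point S a x = T ! a ! x" "third_point S b x = T ! b ! x" if "x \<in> set ?c" for x
      using frame_third(2)[OF S, of x] that c ab b by auto
  qed
  from cycles_meet_eq[OF sts cyc this x(1)] x(2) c show "set xs = {..<10}" by simp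
qed

text \<open>A 4-cycle and a 6-cycle of one pair would have to lie among the six inner
  vertices of its cycle graph, where the 6-cycle leaves no room.\<close>

lemma family_pure:
  assumes S: "S \<in> frame_family T"
  shows "\<not> has_mixed_pair S"
proof
  note sts = family_sts(1)[OF S]
  assume "has_mixed_pair S"
  then obtain a b xs ys where *: "is_cycle_in S a b xs" "is_cycle_in S a b ys"
    "length xs = 4" "length ys = 6"
    unfolding has_mixed_pair_def by blast
  have "\<exists>d e. d < e \<and> is_cycle_in S d e xs \<and> is_cycle_in S d e ys"
  proof (cases "a < b")
    case False
    moreover have "a \<noteq> b" using *(1) by (simp add: is_cycle_in_def)
    ultimately have "b < a" by simp
    then show ?thesis using is_cycle_in_commute[OF sts *(1)] is_cycle_in_commute[OF sts *(2)] by blast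
  qed (use * in blast)
  then obtain d e where de: "d < e" and cyc: "is_cycle_in S d e xs" "is_cycle_in S d e ys" by blast
  have dep: "d \<in> points S" "e \<in> points S" "d \<noteq> e" using cyc(1) by (auto simp: is_cycle_in_def)
  have "\<not> 4 dvd (6::nat)" by simp
  then have d: "10 \<le> d"
    using outer_pair(1)[OF S cyc(2) de] mixed_pair[OF S cyc(2)] *(4) by fastforce
  have e: "e < 19" using dep(2) family_sts(2)[OF S] by simp
  let ?c = "third_point S d e" and ?W = "{10..<19} - {d, e, third_point S d e}"
  note c = third_point_props[OF sts dep]
  have cards: "card (set xs) = 4" "card (set ys) = 6"
    using *(3,4) cycle_length_card[OF cyc(1)] cycle_length_card[OF cyc(2)] by simp_all
  have "card {..<10::nat} = 10" by simp
  with cards have "set xs \<noteq> {..<10}" "set ys \<noteq> {..<10}" by force+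
  then have disj: "set xs \<inter> {..<10} = {}" "set ys \<inter> {..<10} = {}"
    using inner_pair[OF S cyc(1) d de] inner_pair[OF S cyc(2) d de] by blast+
  have sub: "set zs \<subseteq> ?W" if "is_cycle_in S d e zs" "set zs \<inter> {..<10} = {}" for zs
  proof
    fix z assume z: "z \<in> set zs"
    then have "z \<in> cycle_graph_verts S d e" using that(1) by (auto simp: is_cycle_in_def)
    moreover have "10 \<le> z" using that(2) z by (force simp: disjoint_iff)
    ultimately show "z \<in> ?W" using family_sts(2)[OF S] by (auto simp: cycle_graph_verts_def)
  qed
  have "10 \<le> ?c" "?c < 19"
    using inner_closed[OF S d _ _ e dep(3)] de d e c(1) family_sts(2)[OF S] by auto
  then have "card ?W = 6"
    using d de e c(2,3) by (subst card_Diff_subset) (auto simp: card_insert_if)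
  then have "set ys = ?W"
    using sub[OF cyc(2) disj(2)] cards(2) by (intro card_subset_eq) simp_all
  then have "set xs \<subseteq> set ys" using sub[OF cyc(1) disj(1)] by simp
  moreover obtain x where "x \<in> set xs" using cards(1) by fastforce
  ultimately have "set xs = set ys" using cycles_meet_eq[OF sts cyc] by blast
  then show False using cards(1) cards(2) by simp
qed

lemma frame_block_form:
  assumes K: "K \<in> blocks (table_system T)" "K \<inter> {..<10} \<noteq> {}"
  obtains u w x where "K = {u, w, x}" "u < 10" "w < 10" "u \<noteq> w" "10 \<le> x" "x < 19"
proof -
  obtain u where u: "u \<in> K" "u < 10" using K(2) by auto
  have "card K = 3" "K \<subseteq> {..<19}"
    using sts_blockD[OF sts_table_system[OF T] K(1)] by (auto simp: table_system_def len)
  then obtain y where y: "y \<in> K" "y \<noteq> u" "y < 19" using u by (auto simp: card_3_iff)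
  have Ky: "K = {u, y, T ! u ! y}" using table_block_eq[OF T K(1) u(1) y(1)] y(2) by blast
  have iff: "T ! u ! y < 10 \<longleftrightarrow> 10 \<le> y"
    using table_split[OF u(2) y(3)] y(2) by blast
  have z: "T ! u ! y < 19" "T ! u ! y \<noteq> u"
    using steiner_tableD(2)[OF T, of u y] steiner_table_neq(1)[OF T, of u y] u(2) y(2,3) len by auto
  show thesis
  proof (cases "10 \<le> y")
    case True
    then show ?thesis using that[of u "T ! u ! y" y] iff z u(2) y(3) Ky by auto
  next
    case False
    then show ?thesis using that[of u y "T ! u ! y"] iff z u(2) y(2) Ky by auto
  qed
qed

text \<open>A cycle on inner points leaves the prescribed blocks alone.  A cycle on the outer points
  moves exactly those prescribed blocks that contain \<open>a\<close> or \<open>b\<close>, and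
  interchanging \<open>a\<close> and \<open>b\<close> restores them.\<close>

lemma family_closed:
  assumes S: "S \<in> frame_family T" and cyc: "is_cycle_in S a b xs" and l: "length xs \<in> {6, 10}"
    and sw: "sts 19 (cycle_switch S a b xs)"
  shows "\<exists>R\<in>frame_family T. sts_iso (cycle_switch S a b xs) R"
proof -
  note sts = family_sts(1)[OF S]
  obtain d e where de: "d < e" "is_cycle_in S d e xs"
    and eq: "cycle_switch S a b xs = cycle_switch S d e xs"
    using sts_cycle_less[OF sts cyc] by metis
  let ?S' = "cycle_switch S d e xs" and ?t = "\<lambda>K. transpose d e ` K"
  have sts': "sts 19 ?S'" using sw eq by simp
  have P: "points ?S' = {..<19}" using family_sts(2)[OF S] by (simp add: cycle_switch_def)
  have dep: "d \<in> points S" "e \<in> points S" using de(2) by (auto simp: is_cycle_in_def)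
  have "\<not> 4 dvd length xs" using l by auto
  then have d: "10 \<le> d"
    using outer_pair[OF S de(2,1)] mixed_pair[OF S de(2)] l by fastforce
  define h where "h K = (if (d \<in> K \<or> e \<in> K) \<and> K \<inter> set xs \<noteq> {} then ?t K else K)" for K
  have B: "blocks ?S' = h ` blocks S"
    unfolding cycle_switch_blocks[OF sts de(2)] h_def ..
  have F: "K \<in> blocks S" if "K \<in> blocks (table_system T)" "K \<inter> {..<10} \<noteq> {}" for K
    using S that unfolding frame_family_def by blast
  from inner_pair[OF S de(2) d de(1)] have "\<exists>R\<in>frame_family T. sts_iso ?S' R"
  proof
    assume X: "set xs \<inter> {..<10} = {}"
    have "K \<in> blocks ?S'" if K: "K \<in> blocks (table_system T)" "K \<inter> {..<10} \<noteq> {}" for K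
    proof -
      obtain u w x where "K = {u, w, x}" "u < 10" "w < 10" "10 \<le> x"
        using frame_block_form[OF K] by metis
      moreover have "d \<notin> set xs" "e \<notin> set xs"
        using de(2) by (auto simp: is_cycle_in_def cycle_graph_verts_def)
      ultimately have "h K = K" using X d de(1) unfolding h_def by auto
      then show ?thesis unfolding B using F[OF K] by (metis imageI)
    qed
    then have "?S' \<in> frame_family T" using sts' P by (auto simp: frame_family_def)
    then show ?thesis using sts_iso_refl by blast
  next
    assume X: "set xs = {..<10}"
    let ?R = "({..<19}, ?t ` blocks ?S')"
    have iso: "sts_iso ?S' ?R"
      unfolding sts_iso_def
      using dep family_sts(2)[OF S] by (intro exI[of _ "transpose d e"]) (simp add: P bij_betw_transpose_iff)
    have "K \<in> ?t ` blocks ?S'" if K: "K \<in> blocks (table_system T)" "K \<inter> {..<10} \<noteq> {}" for K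
    proof -
      have "?t (h K) = K"
      proof (cases "d \<in> K \<or> e \<in> K")
        case True
        moreover have "K \<inter> set xs \<noteq> {}" using K(2) X by simp
        ultimately show ?thesis unfolding h_def by (simp add: image_image)
      next
        case False
        then have "?t K = K" by (force simp: transpose_def image_iff)
        then show ?thesis using False unfolding h_def by simp
      qed
      then show ?thesis unfolding B using F[OF K] by (metis imageI)
    qed
    then have "?R \<in> frame_family T"
      using sts_iso_sts[OF sts' iso] by (auto simp: frame_family_def)
    then show ?thesis using iso by blast
  qed
  then show ?thesis unfolding eq .
qed

end

section \<open>The five systems\<close>

definition twin_table1 :: "nat list list" where
  "twin_table1 =
   [[0, 15, 6, 14, 10, 9, 2, 11, 13, 5, 4, 7, 17, 8, 3, 1, 18, 12, 16],
    [15, 1, 5, 13, 12, 2, 7, 6, 9, 8, 11, 10, 4, 3, 16, 0, 14, 18, 17],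
    [6, 5, 2, 15, 16, 1, 0, 9, 12, 7, 13, 18, 8, 10, 17, 3, 4, 14, 11],
    [14, 13, 15, 3, 17, 16, 11, 18, 10, 12, 8, 6, 9, 1, 0, 2, 5, 4, 7],
    [10, 12, 16, 17, 4, 13, 8, 15, 6, 18, 0, 14, 1, 5, 11, 7, 2, 3, 9],
    [9, 2, 1, 16, 13, 5, 18, 10, 14, 0, 7, 12, 11, 4, 8, 17, 3, 15, 6],
    [2, 7, 0, 11, 8, 18, 6, 1, 4, 14, 12, 3, 10, 15, 9, 13, 17, 16, 5],
    [11, 6, 9, 18, 15, 10, 1, 7, 17, 2, 5, 0, 16, 14, 13, 4, 12, 8, 3],
    [13, 9, 12, 10, 6, 14, 4, 17, 8, 1, 3, 16, 2, 0, 5, 18, 11, 7, 15],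
    [5, 8, 7, 12, 18, 0, 14, 2, 1, 9, 17, 15, 3, 16, 6, 11, 13, 10, 4],
    [4, 11, 13, 8, 0, 7, 12, 5, 3, 17, 10, 1, 6, 2, 18, 16, 15, 9, 14],
    [7, 10, 18, 6, 14, 12, 3, 0, 16, 15, 1, 11, 5, 17, 4, 9, 8, 13, 2],
    [17, 4, 8, 9, 1, 11, 10, 16, 2, 3, 6, 5, 12, 18, 15, 14, 7, 0, 13],
    [8, 3, 10, 1, 5, 4, 15, 14, 0, 16, 2, 17, 18, 13, 7, 6, 9, 11, 12],
    [3, 16, 17, 0, 11, 8, 9, 13, 5, 6, 18, 4, 15, 7, 14, 12, 1, 2, 10],
    [1, 0, 3, 2, 7, 17, 13, 4, 18, 11, 16, 9, 14, 6, 12, 15, 10, 5, 8],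
    [18, 14, 4, 5, 2, 3, 17, 12, 11, 13, 15, 8, 7, 9, 1, 10, 16, 6, 0],
    [12, 18, 14, 4, 3, 15, 16, 8, 7, 10, 9, 13, 0, 11, 2, 5, 6, 17, 1],
    [16, 17, 11, 7, 9, 6, 5, 3, 15, 4, 14, 2, 13, 12, 10, 8, 0, 1, 18]]"

definition twin_table2 :: "nat list list" where
  "twin_table2 =
   [[0, 15, 6, 14, 10, 9, 2, 8, 7, 5, 4, 13, 17, 11, 3, 1, 18, 12, 16],
    [15, 1, 5, 13, 12, 2, 7, 6, 9, 8, 11, 10, 4, 3, 16, 0, 14, 18, 17],
    [6, 5, 2, 15, 16, 1, 0, 9, 12, 7, 13, 18, 8, 10, 17, 3, 4, 14, 11],
    [14, 13, 15, 3, 17, 16, 11, 18, 10, 12, 8, 6, 9, 1, 0, 2, 5, 4, 7],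
    [10, 12, 16, 17, 4, 13, 8, 15, 6, 18, 0, 14, 1, 5, 11, 7, 2, 3, 9],
    [9, 2, 1, 16, 13, 5, 18, 10, 14, 0, 7, 12, 11, 4, 8, 17, 3, 15, 6],
    [2, 7, 0, 11, 8, 18, 6, 1, 4, 14, 12, 3, 10, 15, 9, 13, 17, 16, 5],
    [8, 6, 9, 18, 15, 10, 1, 7, 0, 2, 5, 17, 16, 14, 13, 4, 12, 11, 3],
    [7, 9, 12, 10, 6, 14, 4, 0, 8, 1, 3, 16, 2, 17, 5, 18, 11, 13, 15],
    [5, 8, 7, 12, 18, 0, 14, 2, 1, 9, 17, 15, 3, 16, 6, 11, 13, 10, 4],
    [4, 11, 13, 8, 0, 7, 12, 5, 3, 17, 10, 1, 6, 2, 18, 16, 15, 9, 14],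
    [13, 10, 18, 6, 14, 12, 3, 17, 16, 15, 1, 11, 5, 0, 4, 9, 8, 7, 2],
    [17, 4, 8, 9, 1, 11, 10, 16, 2, 3, 6, 5, 12, 18, 15, 14, 7, 0, 13],
    [11, 3, 10, 1, 5, 4, 15, 14, 17, 16, 2, 0, 18, 13, 7, 6, 9, 8, 12],
    [3, 16, 17, 0, 11, 8, 9, 13, 5, 6, 18, 4, 15, 7, 14, 12, 1, 2, 10],
    [1, 0, 3, 2, 7, 17, 13, 4, 18, 11, 16, 9, 14, 6, 12, 15, 10, 5, 8],
    [18, 14, 4, 5, 2, 3, 17, 12, 11, 13, 15, 8, 7, 9, 1, 10, 16, 6, 0],
    [12, 18, 14, 4, 3, 15, 16, 11, 13, 10, 9, 7, 0, 8, 2, 5, 6, 17, 1],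
    [16, 17, 11, 7, 9, 6, 5, 3, 15, 4, 14, 2, 13, 12, 10, 8, 0, 1, 18]]"

definition lone_table :: "nat list list" where
  "lone_table =
   [[0, 10, 8, 16, 18, 17, 14, 9, 2, 7, 1, 12, 11, 15, 6, 13, 3, 5, 4],
    [10, 1, 11, 9, 17, 18, 16, 15, 14, 3, 0, 2, 13, 12, 8, 7, 6, 4, 5],
    [8, 11, 2, 12, 10, 16, 18, 17, 0, 15, 4, 1, 3, 14, 13, 9, 5, 7, 6],
    [16, 9, 12, 3, 13, 11, 17, 18, 10, 1, 8, 5, 2, 4, 15, 14, 0, 6, 7],
    [18, 17, 10, 13, 4, 14, 12, 16, 15, 11, 2, 9, 6, 3, 5, 8, 7, 1, 0],
    [17, 18, 16, 11, 14, 5, 15, 13, 9, 8, 12, 3, 10, 7, 4, 6, 2, 0, 1],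
    [14, 16, 18, 17, 12, 15, 6, 8, 7, 10, 9, 13, 4, 11, 0, 5, 1, 3, 2],
    [9, 15, 17, 18, 16, 13, 8, 7, 6, 0, 11, 10, 14, 5, 12, 1, 4, 2, 3],
    [2, 14, 0, 10, 15, 9, 7, 6, 8, 5, 3, 17, 18, 16, 1, 4, 13, 11, 12],
    [7, 3, 15, 1, 11, 8, 10, 0, 5, 9, 6, 4, 16, 18, 17, 2, 12, 14, 13],
    [1, 0, 4, 8, 2, 12, 9, 11, 3, 6, 10, 7, 5, 17, 18, 16, 15, 13, 14],
    [12, 2, 1, 5, 9, 3, 13, 10, 17, 4, 7, 11, 0, 6, 16, 18, 14, 8, 15],
    [11, 13, 3, 2, 6, 10, 4, 14, 18, 16, 5, 0, 12, 1, 7, 17, 9, 15, 8],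
    [15, 12, 14, 4, 3, 7, 11, 5, 16, 18, 17, 6, 1, 13, 2, 0, 8, 10, 9],
    [6, 8, 13, 15, 5, 4, 0, 12, 1, 17, 18, 16, 7, 2, 14, 3, 11, 9, 10],
    [13, 7, 9, 14, 8, 6, 5, 1, 4, 2, 16, 18, 17, 0, 3, 15, 10, 12, 11],
    [3, 6, 5, 0, 7, 2, 1, 4, 13, 12, 15, 14, 9, 8, 11, 10, 16, 18, 17],
    [5, 4, 7, 6, 1, 0, 3, 2, 11, 14, 13, 8, 15, 10, 9, 12, 18, 17, 16],
    [4, 5, 6, 7, 0, 1, 2, 3, 12, 13, 14, 15, 8, 9, 10, 11, 17, 16, 18]]"

definition frame_table :: "nat list list" where
  "frame_table =
   [[0, 10, 11, 12, 13, 14, 15, 16, 17, 18, 1, 2, 3, 4, 5, 6, 7, 8, 9],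
    [10, 1, 13, 11, 17, 18, 16, 14, 12, 15, 0, 3, 8, 2, 7, 9, 6, 4, 5],
    [11, 13, 2, 18, 16, 15, 12, 17, 14, 10, 9, 0, 6, 1, 8, 5, 4, 7, 3],
    [12, 11, 18, 3, 15, 17, 14, 10, 13, 16, 7, 1, 0, 8, 6, 4, 9, 5, 2],
    [13, 17, 16, 15, 4, 10, 11, 12, 18, 14, 5, 6, 7, 0, 9, 3, 2, 1, 8],
    [14, 18, 15, 17, 10, 5, 13, 11, 16, 12, 4, 7, 9, 6, 0, 2, 8, 3, 1],
    [15, 16, 12, 14, 11, 13, 6, 18, 10, 17, 8, 4, 2, 5, 3, 0, 1, 9, 7],
    [16, 14, 17, 10, 12, 11, 18, 7, 15, 13, 3, 5, 4, 9, 1, 8, 0, 2, 6],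
    [17, 12, 14, 13, 18, 16, 10, 15, 8, 11, 6, 9, 1, 3, 2, 7, 5, 0, 4],
    [18, 15, 10, 16, 14, 12, 17, 13, 11, 9, 2, 8, 5, 7, 4, 1, 3, 6, 0],
    [1, 0, 9, 7, 5, 4, 8, 3, 6, 2, 10, 18, 14, 16, 12, 17, 13, 15, 11],
    [2, 3, 0, 1, 6, 7, 4, 5, 9, 8, 18, 11, 13, 12, 17, 16, 15, 14, 10],
    [3, 8, 6, 0, 7, 9, 2, 4, 1, 5, 14, 13, 12, 11, 10, 18, 17, 16, 15],
    [4, 2, 1, 8, 0, 6, 5, 9, 3, 7, 16, 12, 11, 13, 15, 14, 10, 18, 17],
    [5, 7, 8, 6, 9, 0, 3, 1, 2, 4, 12, 17, 10, 15, 14, 13, 18, 11, 16],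
    [6, 9, 5, 4, 3, 2, 0, 8, 7, 1, 17, 16, 18, 14, 13, 15, 11, 10, 12],
    [7, 6, 4, 9, 2, 8, 1, 0, 5, 3, 13, 15, 17, 10, 18, 11, 16, 12, 14],
    [8, 4, 7, 5, 1, 3, 9, 2, 0, 6, 15, 14, 16, 18, 11, 10, 12, 17, 13],
    [9, 5, 3, 2, 8, 1, 7, 6, 4, 0, 11, 10, 15, 17, 16, 12, 14, 13, 18]]"

definition mixed_table :: "nat list list" where
  "mixed_table =
   [[0, 3, 8, 1, 17, 13, 7, 6, 2, 18, 15, 12, 11, 5, 16, 10, 14, 4, 9],
    [3, 1, 4, 0, 2, 9, 14, 8, 7, 5, 18, 16, 13, 12, 6, 17, 11, 15, 10],
    [8, 4, 2, 5, 1, 3, 10, 15, 0, 16, 6, 18, 17, 14, 13, 7, 9, 12, 11],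
    [1, 0, 5, 3, 6, 2, 4, 11, 16, 13, 17, 7, 18, 9, 15, 14, 8, 10, 12],
    [17, 2, 1, 6, 4, 7, 3, 5, 12, 11, 14, 9, 8, 18, 10, 16, 15, 0, 13],
    [13, 9, 3, 2, 7, 5, 8, 4, 6, 1, 12, 15, 10, 0, 18, 11, 17, 16, 14],
    [7, 14, 10, 4, 3, 8, 6, 0, 5, 17, 2, 13, 16, 11, 1, 18, 12, 9, 15],
    [6, 8, 15, 11, 5, 4, 0, 7, 1, 10, 9, 3, 14, 17, 12, 2, 18, 13, 16],
    [2, 7, 0, 16, 12, 6, 5, 1, 8, 14, 11, 10, 4, 15, 9, 13, 3, 18, 17],
    [18, 5, 16, 13, 11, 1, 17, 10, 14, 9, 7, 4, 15, 3, 8, 12, 2, 6, 0],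
    [15, 18, 6, 17, 14, 12, 2, 9, 11, 7, 10, 8, 5, 16, 4, 0, 13, 3, 1],
    [12, 16, 18, 7, 9, 15, 13, 3, 10, 4, 8, 11, 0, 6, 17, 5, 1, 14, 2],
    [11, 13, 17, 18, 8, 10, 16, 14, 4, 15, 5, 0, 12, 1, 7, 9, 6, 2, 3],
    [5, 12, 14, 9, 18, 0, 11, 17, 15, 3, 16, 6, 1, 13, 2, 8, 10, 7, 4],
    [16, 6, 13, 15, 10, 18, 1, 12, 9, 8, 4, 17, 7, 2, 14, 3, 0, 11, 5],
    [10, 17, 7, 14, 16, 11, 18, 2, 13, 12, 0, 5, 9, 8, 3, 15, 4, 1, 6],
    [14, 11, 9, 8, 15, 17, 12, 18, 3, 2, 13, 1, 6, 10, 0, 4, 16, 5, 7],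
    [4, 15, 12, 10, 0, 16, 9, 13, 18, 6, 3, 14, 2, 7, 11, 1, 5, 17, 8],
    [9, 10, 11, 12, 13, 14, 15, 16, 17, 0, 1, 2, 3, 4, 5, 6, 7, 8, 18]]"

text \<open>Turns a table into one rewrite rule per entry, so that a lookup does not traverse the
  table.\<close>

lemma table_entries:
  assumes "T = rs" "list_all (\<lambda>r. length r = 19) rs" "length rs = 19"
  shows "list_all2 (\<lambda>x r. list_all2 (\<lambda>y z. T ! x ! y = z)
      [0, 1, 2, 3, 4, 5, 6, 7, 8, 9, 10, 11, 12, 13, 14, 15, 16, 17, 18] r)
      [0, 1, 2, 3, 4, 5, 6, 7, 8, 9, 10, 11, 12, 13, 14, 15, 16, 17, 18] rs"
proof -
  have upt: "[0, 1, 2, 3, 4, 5, 6, 7, 8, 9, 10, 11, 12, 13, 14, 15, 16, 17, 18] = [0..<19]" by (simp add: upt_rec)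
  show ?thesis unfolding upt using assms by (auto simp add: list_all2_conv_all_nth list_all_length)
qed

lemmas entries =
  table_entries[OF twin_table1_def, simplified] table_entries[OF twin_table2_def, simplified]
  table_entries[OF lone_table_def, simplified] table_entries[OF frame_table_def, simplified]
  table_entries[OF mixed_table_def, simplified]

lemma lengths:
  "length twin_table1 = 19" "length twin_table2 = 19" "length lone_table = 19"
  "length frame_table = 19" "length mixed_table = 19"
  by (simp_all add: twin_table1_def twin_table2_def lone_table_def frame_table_def mixed_table_def)

lemma upt_unfold:
  "[0..<19] = [0, 1, 2, 3, 4, 5, 6, 7, 8, 9, 10, 11, 12, 13, 14, 15, 16, 17, 18]"
  "[0..<10] = [0, 1, 2, 3, 4, 5, 6, 7, 8, 9]" "[10..<19] = [10, 11, 12, 13, 14, 15, 16, 17, 18]"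
  by (simp_all add: upt_rec)

lemmas compute = entries lengths upt_unfold table_cycles_def trace_numeral cycles_verified_def
  cyclic_walk_def switch_iso_def maps_block_def transpose_def pair_closed_def

lemma steiner_tables:
  "steiner_table twin_table1" "steiner_table twin_table2" "steiner_table lone_table"
  "steiner_table frame_table" "steiner_table mixed_table"
  by (simp_all add: steiner_table_def entries lengths upt_unfold cong: Ball_weak_cong)

text \<open>The second twin is the first one after its Pasch switch on the same points, so the
  identity serves as the isomorphism.\<close>

lemma twin_closed1: "table_closed twin_table1 [4, 12] twin_table2 [0..<19]"
  by (simp add: table_closed_def compute cong: Ball_weak_cong)

lemma twin_closed2: "table_closed twin_table2 [4, 12] twin_table1 [0..<19]"
  by (simp add: table_closed_def compute cong: Ball_weak_cong)

text \<open>The pair of type 8 + 8 is 16, 17; its two cycles have the vertex sets \<open>{..<8}\<close> and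
  \<open>{8..<16}\<close>, which the isomorphism exchanges.\<close>

lemma lone_closed: "table_closed lone_table [8] lone_table
    [8, 9, 10, 11, 12, 13, 14, 15, 3, 4, 5, 6, 7, 0, 1, 2, 16, 17, 18]"
  by (simp add: table_closed_def compute cong: Ball_weak_cong)

interpretation frame frame_table
proof
  show "steiner_table frame_table" "length frame_table = 19" by (simp_all add: steiner_tables lengths)
  show "frame_split frame_table"
    by (simp add: frame_split_def entries upt_unfold cong: Ball_weak_cong)
  show "frame_outer frame_table"
    by (simp add: frame_outer_def compute cong: Ball_weak_cong)
  show "frame_perfect frame_table"
    by (simp add: frame_perfect_def spans_outer_def compute cong: Ball_weak_cong)
qed

definition shows_cycle :: "nat list list \<Rightarrow> nat \<Rightarrow> nat \<Rightarrow> nat list list \<Rightarrow> nat \<Rightarrow> bool" where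
  "shows_cycle T a b cs l \<longleftrightarrow> a < length T \<and> b < length T \<and> a \<noteq> b \<and>
     cycles_verified T a b cs \<and> l \<in> length ` set cs"

lemma shows_cycle_exists:
  assumes "steiner_table T" "shows_cycle T a b cs l"
  obtains c where "is_cycle_in (table_system T) a b c" "length c = l"
  using table_cycle_exists[OF assms(1), of a b cs l] assms(2) unfolding shows_cycle_def by blast

lemma shows_cycle_has_cycle:
  "steiner_table T \<Longrightarrow> shows_cycle T a b cs l \<Longrightarrow> has_cycle l (table_system T)"
  unfolding has_cycle_def using shows_cycle_exists by metis

lemma twin_cycles: "l \<in> {4, 12} \<Longrightarrow> has_cycle l (table_system twin_table1)"
proof -
  assume "l \<in> {4, 12}"
  then have "shows_cycle twin_table1 8 11 (table_cycles twin_table1 8 11) l"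
    by (elim insertE emptyE) (simp_all add: shows_cycle_def compute cong: Ball_weak_cong)
  then show ?thesis by (rule shows_cycle_has_cycle[OF steiner_tables(1)])
qed

lemma lone_cycles: "has_cycle 8 (table_system lone_table)" "has_cycle 16 (table_system lone_table)"
proof -
  have "shows_cycle lone_table 16 17 (table_cycles lone_table 16 17) 8"
    "shows_cycle lone_table 0 2 (table_cycles lone_table 0 2) 16"
    by (simp_all add: shows_cycle_def compute cong: Ball_weak_cong)
  then show "has_cycle 8 (table_system lone_table)" "has_cycle 16 (table_system lone_table)"
    by (auto intro: shows_cycle_has_cycle[OF steiner_tables(3)])
qed

lemma frame_cycles: "l \<in> {6, 10} \<Longrightarrow> has_cycle l (table_system frame_table)"
proof -
  assume "l \<in> {6, 10}"
  then have "shows_cycle frame_table 10 11 (table_cycles frame_table 10 11) l"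
    by (elim insertE emptyE) (simp_all add: shows_cycle_def compute cong: Ball_weak_cong)
  then show ?thesis by (rule shows_cycle_has_cycle[OF steiner_tables(4)])
qed

lemma mixed_cycles:
  "l \<in> {4, 6, 8, 10, 12, 16} \<Longrightarrow> has_cycle l (table_system mixed_table)"
  "has_mixed_pair (table_system mixed_table)"
proof -
  let ?s = "\<lambda>a b. shows_cycle mixed_table a b (table_cycles mixed_table a b)"
  have c: "?s 9 10 4" "?s 9 10 6" "?s 9 11 8" "?s 2 9 10" "?s 0 2 12" "?s 0 1 16"
    by (simp_all add: shows_cycle_def compute cong: Ball_weak_cong)
  note cyc = c[THEN shows_cycle_has_cycle[OF steiner_tables(5)]]
  show "has_cycle l (table_system mixed_table)" if "l \<in> {4, 6, 8, 10, 12, 16}"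
    using that by (elim insertE emptyE) (simp_all only: cyc)
  obtain c d where "is_cycle_in (table_system mixed_table) 9 10 c" "length c = 4"
    "is_cycle_in (table_system mixed_table) 9 10 d" "length d = 6"
    using shows_cycle_exists[OF steiner_tables(5) c(1)] shows_cycle_exists[OF steiner_tables(5) c(2)]
    by metis
  then show "has_mixed_pair (table_system mixed_table)" unfolding has_mixed_pair_def by blast
qed

section \<open>Disconnectedness for each length\<close>

lemma disconnected_by_table_family:
  fixes \<R> :: "nat system set"
  assumes "\<And>R. R \<in> \<R> \<Longrightarrow> sts 19 R"
    and "\<And>R a b xs. R \<in> \<R> \<Longrightarrow> is_cycle_in R a b xs \<Longrightarrow> length xs = l \<Longrightarrow>
      sts 19 (cycle_switch R a b xs) \<Longrightarrow> \<exists>R'\<in>\<R>. sts_iso (cycle_switch R a b xs) R'"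
    and "\<And>R. R \<in> \<R> \<Longrightarrow> \<not> has_mixed_pair R" "B \<in> \<R>" "has_cycle l B"
    and "l \<in> {4, 6, 8, 10, 12, 16}"
  shows "disconnected (with_proj (switching_graph l 19)) \<and>
    disconnected (reduced_switching_graph l 19)"
  by (rule disconnected_by_family[OF assms(1-5) _ mixed_cycles(2) mixed_cycles(1)[OF assms(6)]])
    (use sts_table_system[OF steiner_tables(5)] lengths in simp_all)

theorem mainTheorem1:
  fixes l :: nat
  assumes "l \<in> {4, 6, 8, 10, 12, 16}"
  shows "disconnected (with_proj (switching_graph l 19)) \<and>
         disconnected (reduced_switching_graph l 19)"
proof -
  let ?A = "table_system twin_table1" and ?B = "table_system twin_table2"
    and ?L = "table_system lone_table"
  note sts_tab = sts_table_system[OF steiner_tables(1)] sts_table_system[OF steiner_tables(2)]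
    sts_table_system[OF steiner_tables(3)]
  note sts_AB = sts_tab[unfolded lengths]
  consider "l \<in> {4, 12}" | "l = 8" | "l = 16" | "l \<in> {6, 10}" using assms by auto
  then show ?thesis
  proof cases
    case 1
    have A: "sts_iso (cycle_switch ?A a b xs) ?B"
      if "is_cycle_in ?A a b xs" "length xs = l" "sts 19 (cycle_switch ?A a b xs)" for a b xs
      by (rule table_closed_switch[OF steiner_tables(1,2) _ twin_closed1 that(1)])
        (use 1 that lengths in auto)
    have B: "sts_iso (cycle_switch ?B a b xs) ?A"
      if "is_cycle_in ?B a b xs" "length xs = l" "sts 19 (cycle_switch ?B a b xs)" for a b xs
      by (rule table_closed_switch[OF steiner_tables(2,1) _ twin_closed2 that(1)])
        (use 1 that lengths in auto)
    show ?thesis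
    proof (rule disconnected_by_table_family[where \<R> = "{?A, ?B}", OF _ _ _ _ twin_cycles[OF 1] assms])
      show "sts 19 R" if "R \<in> {?A, ?B}" for R using that sts_AB by blast
      show "\<not> has_mixed_pair R" if "R \<in> {?A, ?B}" for R
        using that table_closed_pure[OF steiner_tables(1) twin_closed1]
          table_closed_pure[OF steiner_tables(2) twin_closed2] by blast
      show "\<exists>R'\<in>{?A, ?B}. sts_iso (cycle_switch R a b xs) R'"
        if "R \<in> {?A, ?B}" "is_cycle_in R a b xs" "length xs = l" "sts 19 (cycle_switch R a b xs)"
        for R a b xs
        using that A[of a b xs] B[of a b xs] by (elim insertE emptyE) simp_all
    qed simp
  next
    case 2
    show ?thesis
    proof (rule disconnected_by_table_family[where \<R> = "{?L}" and B = ?L, OF _ _ _ _ _ assms])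
      show "sts 19 R" if "R \<in> {?L}" for R using that sts_AB by blast
      show "\<not> has_mixed_pair R" if "R \<in> {?L}" for R
        using that table_closed_pure[OF steiner_tables(3) lone_closed] by blast
      show "\<exists>R'\<in>{?L}. sts_iso (cycle_switch R a b xs) R'"
        if "R \<in> {?L}" "is_cycle_in R a b xs" "length xs = l" "sts 19 (cycle_switch R a b xs)"
        for R a b xs
        using table_closed_switch[OF steiner_tables(3,3) _ lone_closed, of a b xs] that 2 lengths by simp
      show "has_cycle l ?L" using lone_cycles(1) 2 by simp
    qed simp
  next
    case 3
    show ?thesis
    proof (rule disconnected_by_table_family[where \<R> = "{?L}" and B = ?L, OF _ _ _ _ _ assms])
      show "sts 19 R" if "R \<in> {?L}" for R using that sts_AB by blast
      show "\<not> has_mixed_pair R" if "R \<in> {?L}" for R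
        using that table_closed_pure[OF steiner_tables(3) lone_closed] by blast
      show "\<exists>R'\<in>{?L}. sts_iso (cycle_switch R a b xs) R'"
        if "R \<in> {?L}" "is_cycle_in R a b xs" "length xs = l" "sts 19 (cycle_switch R a b xs)"
        for R a b xs
        using hamiltonian_switch[OF sts_AB(3), of a b xs] that 3 by simp
      show "has_cycle l ?L" using lone_cycles(2) 3 by simp
    qed simp
  next
    case 4
    show ?thesis
      by (rule disconnected_by_table_family[where \<R> = "frame_family frame_table",
            OF family_sts(1) _ family_pure in_family frame_cycles[OF 4] assms])
        (use family_closed 4 in metis)+
  qed
qed

end
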